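(* Assume that $G$ and $R$ are both standard in $T$: there exist constants $C>0$ and $\varepsilon_0>0$ such that for all $\varepsilon\in(0,\varepsilon_0]$ and all $t\in T$, $$P_X(B(t,\varepsilon))\ge C\,\mu(B(t,\varepsilon))\quad\text{and}\quad P_Y(B(t,\varepsilon))\ge C\,\mu(B(t,\varepsilon)).$$ Assume also that the function $F(\varepsilon):=\mu(B(T,\varepsilon))$, $\varepsilon\ge0$, is differentiable in a (right) neighborhood of $0$ and that its derivative $F'$ is continuous at $0$ (one-sided at $0$). Let $\{\varepsilon_n\}$ be a deterministic sequence of positive numbers with $\varepsilon_n\to0$. (a) There is a constant $K>0$ (not depending on $n$) such that, with $$I_n=\frac{1}{\varepsilon_n}\int_{B(T,\varepsilon_n)}\exp\bigl(-Kn(\varepsilon_n-d(z,T))^d\bigr)\,dz,$$ one has for all $n$ $$E|L_n-L_0|\le I_n+|L(\varepsilon_n)-L_0|.\qquad( * )$$ As a consequence, if $\varepsilon_n\to0$ and $n\varepsilon_n^d\to\infty$, then $E|L_n-L_0|\to0$. (b) Assume further that $G$ and $\overline{R}$ (the closure of $R$) both have positive reach. Then the right-hand side of $( * )$ is $O\bigl((n\varepsilon_n^d)^{-1/d}+\varepsilon_n\bigr)$, and the optimal order of this bound over the choice of $\{\varepsilon_n\}$ is $n^{-1/(2d)}$, attained for $\varepsilon_n=n^{-1/(2d)}$: that is, for $\varepsilon_n=n^{-1/(2d)}$ the right-hand side of $( * )$, and hence $E|L_n-L_0|$, is $O(n^{-1/(2d)})$, while there is a constant $c>0$ such that $(n\varepsilon_n^d)^{-1/d}+\varepsilon_n\ge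 c\,n^{-1/(2d)}$ for every $n$ and every sequence $\{\varepsilon_n\}$ of positive numbers.
   Context: $\mu$ is Lebesgue measure on $\mathbb{R}^d$ and $\|\cdot\|$ the Euclidean norm; $B(x,\varepsilon)$ is the closed ball with center $x$ and radius $\varepsilon$, and for $A\subset\mathbb{R}^d$, $B(A,\varepsilon)=\bigcup_{x\in A}B(x,\varepsilon)$. $d(z,T)=\inf\{\|z-t\|:t\in T\}$. $G\subset(0,1)^d$ is a body (a compact set with $\mu(G)>0$), $R=[0,1]^d\setminus G$, and $T=\partial G$ is the boundary of $G$. For $\varepsilon>0$ let $L(\varepsilon)=\mu(B(T,\varepsilon))/(2\varepsilon)$. The Minkowski content $L_0=L_0(G)=\lim_{\varepsilon\to0^+}L(\varepsilon)$ is assumed to exist, to be finite and to be strictly positive. The reach of a closed set $A\subset\mathbb{R}^d$ is the largest value $r_0$ (possibly $\infty$) such that every $x\in\mathbb{R}^d$ whose distance to $A$ is smaller than $r_0$ has a unique nearest point in $A$; $A$ has positive reach if $r_0>0$. Sampling model: $(Z_1,\delta_1),(Z_2,\delta_2),\ldots$ are i.i.d. copies of $(Z,\delta)$, where $Z$ is uniformly distributed on $[0,1]^d$, $\delta=1$ if $Z\in G$ and $\delta=0$ if $Z\notin G$. $P_X$ and $P_Y$ denote the conditional distributions of $Z$ given $\delta=1$ and given $\delta=0$, i.e. the uniform distributions on $G$ and $R$ respectively. For $z\in[0,1]^d$ and $\varepsilon\ge0$, let $G_z(\varepsilon)=\#\{i\le n:\delta_i=1,\ \|Z_i-z\|\le\varepsilon\}$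 and $R_z(\varepsilon)=\#\{i\le n:\delta_i=0,\ \|Z_i-z\|\le\varepsilon\}$ (both depend on $n$). Define $$T_n=\{z\in[0,1]^d: R_z(\varepsilon_n)\ge1\text{ and }G_z(\varepsilon_n)\ge1\},\qquad L_n=\frac{\mu(T_n)}{2\varepsilon_n}.$$ *)

theory Defs
  imports "HOL-Probability.Probability"
begin

text \<open>
  The ambient space is \<open>real ^ 'd\<close>, so the dimension \<open>d \<ge> 1\<close> is \<open>CARD('d)\<close>. The cubes
  \<open>[0,1]^d\<close> and \<open>(0,1)^d\<close> are \<open>cbox 0 1\<close> and \<open>box 0 1\<close>, where \<open>1\<close> is the all-ones vector.
  Volumes are taken in \<open>lborel\<close>; every set measured below is Borel (indeed closed, apart
  from \<open>cbox 0 1 - G\<close>), so this is Lebesgue measure.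
\<close>

definition ball_nbhd :: "'a::metric_space set \<Rightarrow> real \<Rightarrow> 'a set" where
  "ball_nbhd A \<epsilon> = (\<Union>x\<in>A. cball x \<epsilon>)"

definition tube_volume :: "'a::euclidean_space set \<Rightarrow> real \<Rightarrow> real" where
  "tube_volume G \<epsilon> = measure lborel (ball_nbhd (frontier G) \<epsilon>)"

definition tube_ratio :: "'a::euclidean_space set \<Rightarrow> real \<Rightarrow> real" where
  "tube_ratio G \<epsilon> = tube_volume G \<epsilon> / (2 * \<epsilon>)"

text \<open>The set of admissible radii is closed under suprema, so its supremum is its largest element.\<close>

definition reach :: "'a::metric_space set \<Rightarrow> ennreal" where
  "reach A = Sup {r. \<forall>x. ennreal (infdist x A) < r \<longrightarrow>
                         (\<exists>!a. a \<in> A \<and> dist x a = infdist x A)}"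

definition iid_copies ::
  "'w measure \<Rightarrow> 'b measure \<Rightarrow> (nat \<Rightarrow> 'w \<Rightarrow> 'b) \<Rightarrow> 'b measure \<Rightarrow> bool" where
  "iid_copies M N X P \<longleftrightarrow>
     prob_space M \<and> prob_space.indep_vars M (\<lambda>_. N) X {1..} \<and>
     (\<forall>i\<ge>1. distr M N (X i) = P)"

text \<open>The law of \<open>(Z, \<delta>)\<close>, with \<open>Z\<close> uniform on the unit cube and \<open>\<delta>\<close> the label of \<open>Z\<close>.\<close>

definition sample_law :: "(real ^ 'd) set \<Rightarrow> ((real ^ 'd) \<times> nat) measure" where
  "sample_law G =
     distr (uniform_measure lborel (cbox 0 1)) (borel \<Otimes>\<^sub>M count_space UNIV)
       (\<lambda>z. (z, if z \<in> G then 1 else 0))"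

text \<open>
  In the following, \<open>x\<close> and \<open>b\<close> are realisations of the sequences \<open>Z\<close> and \<open>\<delta>\<close>. With
  \<open>k = 1\<close> and \<open>k = 0\<close> the count below is \<open>G\<^sub>z(\<epsilon>)\<close> and \<open>R\<^sub>z(\<epsilon>)\<close>, respectively.
\<close>

definition label_count ::
  "nat \<Rightarrow> (nat \<Rightarrow> real ^ 'd) \<Rightarrow> (nat \<Rightarrow> nat) \<Rightarrow> nat \<Rightarrow> real ^ 'd \<Rightarrow> real \<Rightarrow> nat" where
  "label_count k x b n z \<epsilon> = card {i \<in> {1..n}. b i = k \<and> norm (x i - z) \<le> \<epsilon>}"

definition boundary_est ::
  "(nat \<Rightarrow> real ^ 'd) \<Rightarrow> (nat \<Rightarrow> nat) \<Rightarrow> nat \<Rightarrow> real \<Rightarrow> (real ^ 'd) set" where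
  "boundary_est x b n \<epsilon> =
     {z \<in> cbox 0 1. label_count 0 x b n z \<epsilon> \<ge> 1 \<and> label_count 1 x b n z \<epsilon> \<ge> 1}"

definition content_est ::
  "(nat \<Rightarrow> real ^ 'd) \<Rightarrow> (nat \<Rightarrow> nat) \<Rightarrow> nat \<Rightarrow> real \<Rightarrow> real" where
  "content_est x b n \<epsilon> = measure lborel (boundary_est x b n \<epsilon>) / (2 * \<epsilon>)"

definition abs_error ::
  "(nat \<Rightarrow> 'w \<Rightarrow> real ^ 'd) \<Rightarrow> (nat \<Rightarrow> 'w \<Rightarrow> nat) \<Rightarrow> real \<Rightarrow> nat \<Rightarrow> real \<Rightarrow> 'w \<Rightarrow> real" where
  "abs_error Z \<delta> L0 n \<epsilon> \<omega> = \<bar>content_est (\<lambda>i. Z i \<omega>) (\<lambda>i. \<delta> i \<omega>) n \<epsilon> - L0\<bar>"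

definition exp_term :: "(real ^ 'd) set \<Rightarrow> real \<Rightarrow> nat \<Rightarrow> real \<Rightarrow> real" where
  "exp_term G K n \<epsilon> =
     1 / \<epsilon> * (LINT z : ball_nbhd (frontier G) \<epsilon> | lborel.
                exp (- K * real n * (\<epsilon> - infdist z (frontier G)) ^ CARD('d)))"

definition error_bound :: "(real ^ 'd) set \<Rightarrow> real \<Rightarrow> real \<Rightarrow> nat \<Rightarrow> real \<Rightarrow> real" where
  "error_bound G L0 K n \<epsilon> = exp_term G K n \<epsilon> + \<bar>tube_ratio G \<epsilon> - L0\<bar>"

end

theory Submission
  imports Defs
begin

text \<open>
  Write \<open>T = frontier G\<close>, \<open>\<mu>\<close> for Lebesgue measure, \<open>B(T,\<epsilon>)\<close> for the tube of radius \<open>\<epsilon>\<close>,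
  \<open>F(\<epsilon>)\<close> for its volume and \<open>L(\<epsilon>) = F(\<epsilon>) / (2\<epsilon>)\<close>.

  Part (a). If \<open>z\<close> lies within \<open>\<epsilon>\<close> of a point of \<open>G\<close> and of a point outside \<open>G\<close>, then one of the two
  segments from \<open>z\<close> to these points crosses \<open>T\<close>. So almost surely the estimated set lies in the tube,
  \<open>L(\<epsilon>) - L\<^sub>n\<close> is the volume of the part of the tube that is missed, divided by \<open>2\<epsilon>\<close>, and by Fubini
  its expectation is the integral over the tube of the probability that \<open>z\<close> is missed. If \<open>t\<close> is the
  point of \<open>T\<close> nearest to \<open>z\<close>, the ball around \<open>t\<close> of radius \<open>\<epsilon> - d(z,T)\<close> is contained in the ball
  around \<open>z\<close> of radius \<open>\<epsilon>\<close>; standardness bounds the mass of either label there from below, and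
  independence yields the exponential. This needs \<open>\<epsilon>\<close> small. The finitely many \<open>n\<close> with large
  \<open>\<epsilon> n\<close> are absorbed by a small \<open>K\<close>: a union bound over two labels leaves a factor 2 in front of
  the exponential, so for them the bound is at least 1. The exponential term tends to 0 since away from
  the outer layer of the tube the exponent tends to minus infinity, and a thin outer layer has volume
  proportional to its thickness.

  Part (b), exponential term. Cut the tube into layers of thickness \<open>n powr (-1/d)\<close>. As \<open>F\<close> is
  Lipschitz near 0, each layer has volume \<open>O(n powr (-1/d))\<close>, and the integrand decays geometrically
  from layer to layer.

  Part (b), the bias \<open>L(\<epsilon>) - L0\<close>. If nearest points in \<open>A\<close> are unique up to distance \<open>r\<close>, then a
  ball of any radius below \<open>r\<close> touches \<open>A\<close> from outside at every boundary point: a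
  segment from a boundary point to a point that it is nearest to can be prolonged (Brouwer, \<open>nearest_point_ray_step\<close>), and one passes to the limit
  (\<open>touching_ball_if_unique_proj\<close>). Applied to \<open>G\<close> and to the closure of \<open>R\<close>, this gives at every
  point of \<open>T\<close> a ball inside and a ball outside \<open>G\<close>; they are disjoint, so they have opposite normals.
  By the parallelogram law the unit normal \<open>\<nu>\<close> is Lipschitz on \<open>T\<close>
  (\<open>two_sided_normal_lipschitz\<close>), and \<open>(t,s) \<mapsto> t + s \<nu>(t)\<close> parametrises the tube
  (\<open>ball_nbhd_eq_shell\<close>). Moving the tube of radius \<open>\<epsilon>\<close> by \<open>\<plusminus>\<epsilon>\<close> along the normals gives the two
  halves of the tube of radius \<open>2\<epsilon>\<close>, and these maps and their inverses have Lipschitz constant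
  \<open>1 + O(\<epsilon>)\<close>. A map with Lipschitz constant \<open>c\<close> increases volume at most by the factor \<open>c ^ d\<close>, so
  \<open>F(2\<epsilon>) = 2 F(\<epsilon>) (1 + O(\<epsilon>))\<close> (\<open>tube_volume_doubling\<close>). Hence \<open>L(2\<epsilon>) - L(\<epsilon>) = O(\<epsilon>)\<close>, and
  summing over the halvings of \<open>\<epsilon>\<close> gives \<open>L(\<epsilon>) - L0 = O(\<epsilon>)\<close>.
\<close>

section \<open>Volume under Lipschitz maps\<close>

text \<open>
  By Vitali's covering theorem an open set slightly larger than \<open>S\<close> contains disjoint balls with
  centres in \<open>S\<close> that cover \<open>S\<close> up to a null set. The image of such a ball lies in a ball whose radius is
  multiplied by \<open>L\<close>, and Lipschitz images of null sets are null. Working with balls is what gives the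
  sharp factor, without differentiating \<open>f\<close>.
\<close>

lemma emeasure_lipschitz_image_le:
  fixes f :: "'a::euclidean_space \<Rightarrow> 'a"
  assumes S: "compact S" and L: "L \<ge> 0"
    and lip: "\<And>x y. x \<in> S \<Longrightarrow> y \<in> S \<Longrightarrow> dist (f x) (f y) \<le> L * dist x y"
  shows "emeasure lebesgue (f ` S) \<le> ennreal (L ^ DIM('a)) * emeasure lebesgue S"
proof (rule ennreal_le_epsilon)
  fix e :: real
  assume e: "e > 0"
  let ?d = "DIM('a)"
  have Slm: "S \<in> lmeasurable"
    using S by (simp add: lmeasurable_compact)
  \<comment> \<open>The summand 1 keeps the denominator positive when \<open>L = 0\<close>.\<close>
  define e' where "e' = e / (L ^ ?d + 1)"
  have Ld: "L ^ ?d \<ge> 0" using L by simp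
  then have e': "e' > 0" "L ^ ?d * e' \<le> e"
    using e by (auto simp: e'_def field_simps)
  obtain U where U: "open U" "S \<subseteq> U" "U - S \<in> lmeasurable" "emeasure lebesgue (U - S) < ennreal e'"
    using sets_lebesgue_outer_open[of S e'] e' Slm by auto
  have emU: "emeasure lebesgue U \<le> emeasure lebesgue S + ennreal e'"
  proof -
    have "emeasure lebesgue U = emeasure lebesgue (S \<union> (U - S))"
      using U by (simp add: Un_absorb1)
    also have "\<dots> \<le> emeasure lebesgue S + emeasure lebesgue (U - S)"
      using U Slm by (intro emeasure_subadditive) auto
    finally show ?thesis using U(4) by (meson add_left_mono dual_order.trans less_imp_le)
  qed
  define K where "K = {(x, r). x \<in> S \<and> 0 < r \<and> cball x r \<subseteq> U}"
  have vitali: "\<exists>i. i \<in> K \<and> x \<in> cball (fst i) (snd i) \<and> snd i < d" if "x \<in> S" "0 < d" for x and d :: real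
  proof -
    have "x \<in> U" using U(2) that by blast
    then obtain r where r: "r > 0" "cball x r \<subseteq> U"
      using U(1) open_contains_cball by blast
    have "cball x (min r (d/2)) \<subseteq> cball x r"
      by (rule subset_cball) simp
    then have "(x, min r (d/2)) \<in> K"
      using r that by (auto simp: K_def)
    then show ?thesis
      using that r(1) by (intro exI[of _ "(x, min r (d/2))"]) auto
  qed
  obtain C where C: "countable C" "C \<subseteq> K"
      "pairwise (\<lambda>i j. disjnt (cball (fst i) (snd i)) (cball (fst j) (snd j))) C"
      "negligible (S - (\<Union>i \<in> C. cball (fst i) (snd i)))"
  proof (rule Vitali_covering_theorem_cballs[of K snd S fst])
    show "0 < snd i" if "i \<in> K" for i using that by (auto simp: K_def)
  qed (use vitali in auto)
  define J where "J = to_nat_on C ` C"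
  define X where "X = (\<lambda>k. if k \<in> J then cball (fst (from_nat_into C k)) (snd (from_nat_into C k)) else {})"
  define Y where "Y = (\<lambda>k. if k \<in> J then cball (f (fst (from_nat_into C k))) (L * snd (from_nat_into C k)) else {})"
  have fromJ: "from_nat_into C k \<in> C" if "k \<in> J" for k
    using that C(1) by (auto simp: J_def)
  have injJ: "from_nat_into C k \<noteq> from_nat_into C l" if "k \<in> J" "l \<in> J" "k \<noteq> l" for k l
    using that C(1) by (auto simp: J_def)
  have UX: "(\<Union>k. X k) = (\<Union>i\<in>C. cball (fst i) (snd i))"
  proof -
    have "(\<Union>k. X k) = (\<Union>k\<in>J. cball (fst (from_nat_into C k)) (snd (from_nat_into C k)))"
      by (auto simp: X_def split: if_splits)
    also have "\<dots> = (\<Union>i\<in>C. cball (fst i) (snd i))"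
      using C(1) by (auto simp: J_def)
    finally show ?thesis .
  qed
  have disj: "disjoint_family X"
    unfolding disjoint_family_on_def
  proof safe
    fix k l x assume kl: "k \<noteq> l" and x: "x \<in> X k" "x \<in> X l"
    then have "k \<in> J" "l \<in> J" by (auto simp: X_def split: if_splits)
    then have "disjnt (X k) (X l)"
      using C(3) fromJ injJ kl unfolding pairwise_def X_def by auto
    then show "x \<in> {}" using x by (auto simp: disjnt_def)
  qed
  have XU: "X k \<subseteq> U" for k
  proof (cases "k \<in> J")
    case True
    then have "from_nat_into C k \<in> K" using fromJ C(2) by blast
    then show ?thesis using True by (auto simp: X_def K_def split_beta)
  qed (simp add: X_def)
  have Xm: "X k \<in> sets lebesgue" "Y k \<in> sets lebesgue" for k
    by (auto simp: X_def Y_def)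
  have emY: "emeasure lebesgue (Y k) = ennreal (L ^ ?d) * emeasure lebesgue (X k)" for k
  proof (cases "k \<in> J")
    case True
    then have "snd (from_nat_into C k) > 0"
      using fromJ[OF True] C(2) by (auto simp: K_def)
    then show ?thesis
      using True L by (simp add: X_def Y_def emeasure_cball ennreal_mult'[symmetric] power_mult_distrib mult_ac)
  qed (auto simp: X_def Y_def)
  have fneg: "negligible (f ` (S - (\<Union>k. X k)))"
  proof (rule negligible_locally_Lipschitz_image)
    show "negligible (S - (\<Union>k. X k))" using C(4) UX by simp
    show "\<exists>T B. open T \<and> x \<in> T \<and> (\<forall>y\<in>(S - (\<Union>k. X k)) \<inter> T. norm (f y - f x) \<le> B * norm (y - x))"
      if "x \<in> S - (\<Union>k. X k)" for x
      using lip that by (intro exI[of _ UNIV] exI[of _ L]) (auto simp: dist_norm)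
  qed auto
  have sub: "f ` S \<subseteq> f ` (S - (\<Union>k. X k)) \<union> (\<Union>k. Y k)"
  proof
    fix w assume "w \<in> f ` S"
    then obtain x where x: "x \<in> S" "w = f x" by auto
    show "w \<in> f ` (S - (\<Union>k. X k)) \<union> (\<Union>k. Y k)"
    proof (cases "x \<in> (\<Union>k. X k)")
      case True
      then obtain k where k: "x \<in> X k" by auto
      then have kJ: "k \<in> J" by (auto simp: X_def split: if_splits)
      define c where "c = fst (from_nat_into C k)"
      have "c \<in> S" using fromJ[OF kJ] C(2) by (auto simp: K_def c_def)
      have "dist (f c) (f x) \<le> L * dist c x" using lip \<open>c \<in> S\<close> x by auto
      also have "\<dots> \<le> L * snd (from_nat_into C k)"
        using k kJ L by (intro mult_left_mono) (auto simp: X_def c_def)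
      finally show ?thesis using kJ x by (auto simp: Y_def c_def intro!: exI[of _ k])
    qed (use x in auto)
  qed
  have fneg0: "emeasure lebesgue (f ` (S - (\<Union>k. X k))) = 0" "f ` (S - (\<Union>k. X k)) \<in> sets lebesgue"
    using fneg by (auto simp: negligible_iff_null_sets)
  have "emeasure lebesgue (f ` S) \<le> emeasure lebesgue (f ` (S - (\<Union>k. X k)) \<union> (\<Union>k. Y k))"
    using sub fneg0 Xm by (intro emeasure_mono) auto
  also have "\<dots> \<le> emeasure lebesgue (f ` (S - (\<Union>k. X k))) + emeasure lebesgue (\<Union>k. Y k)"
    using fneg0 Xm by (intro emeasure_subadditive) auto
  also have "\<dots> = emeasure lebesgue (\<Union>k. Y k)" using fneg0 by simp
  also have "\<dots> \<le> (\<Sum>k. emeasure lebesgue (Y k))"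
    using Xm by (intro emeasure_subadditive_countably) auto
  also have "\<dots> = ennreal (L ^ ?d) * (\<Sum>k. emeasure lebesgue (X k))"
    unfolding emY by simp
  also have "(\<Sum>k. emeasure lebesgue (X k)) = emeasure lebesgue (\<Union>k. X k)"
    using Xm disj by (intro suminf_emeasure) auto
  also have "ennreal (L ^ ?d) * emeasure lebesgue (\<Union>k. X k) \<le> ennreal (L ^ ?d) * emeasure lebesgue U"
    using XU U(1) by (intro mult_left_mono emeasure_mono) auto
  also have "\<dots> \<le> ennreal (L ^ ?d) * (emeasure lebesgue S + ennreal e')"
    using emU by (intro mult_left_mono) auto
  also have "\<dots> = ennreal (L ^ ?d) * emeasure lebesgue S + ennreal (L ^ ?d * e')"
    using Ld e' by (simp add: distrib_left ennreal_mult)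
  also have "\<dots> \<le> ennreal (L ^ ?d) * emeasure lebesgue S + ennreal e"
    using e' by (intro add_left_mono ennreal_leI) auto
  finally show "emeasure lebesgue (f ` S) \<le> ennreal (L ^ ?d) * emeasure lebesgue S + ennreal e" .
qed

text \<open>
  The form used for shells: there a map is given not as a function of points of space but by
  two parametrisations over the same index set.
\<close>

lemma measure_lipschitz_reparam_le:
  fixes p q :: "'i \<Rightarrow> 'a::euclidean_space"
  assumes P: "compact (p ` I)" and Q: "compact (q ` I)" and L: "L \<ge> 0"
    and lip: "\<And>i j. i \<in> I \<Longrightarrow> j \<in> I \<Longrightarrow> dist (q i) (q j) \<le> L * dist (p i) (p j)"
  shows "measure lborel (q ` I) \<le> L ^ DIM('a) * measure lborel (p ` I)"
proof -
  define f where "f = (\<lambda>x. q (inv_into I p x))"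
  have lipf: "dist (f x) (f y) \<le> L * dist x y" if "x \<in> p ` I" "y \<in> p ` I" for x y
    using lip[of "inv_into I p x" "inv_into I p y"] that
    by (simp add: f_def inv_into_into f_inv_into_f)
  have f: "f (p i) = q i" if "i \<in> I" for i
  proof -
    have "dist (f (p i)) (q i) \<le> L * dist (p (inv_into I p (p i))) (p i)"
      unfolding f_def using that by (intro lip inv_into_into) auto
    then show ?thesis using that by (simp add: f_inv_into_f)
  qed
  have fimg: "f ` p ` I = q ` I" using f by (auto simp: image_iff)
  have fin: "emeasure lborel (p ` I) < \<infinity>" "emeasure lborel (q ` I) < \<infinity>"
    using emeasure_compact_finite P Q by auto
  have "emeasure lebesgue (q ` I) \<le> ennreal (L ^ DIM('a)) * emeasure lebesgue (p ` I)"
    using emeasure_lipschitz_image_le[OF P L lipf] fimg by simp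
  then have "emeasure lborel (q ` I) \<le> ennreal (L ^ DIM('a)) * emeasure lborel (p ` I)"
    using P Q by (simp add: borel_compact)
  then have "ennreal (measure lborel (q ` I)) \<le> ennreal (L ^ DIM('a) * measure lborel (p ` I))"
    using fin L by (simp add: emeasure_eq_ennreal_measure ennreal_mult)
  then show ?thesis using L by (simp add: ennreal_le_iff)
qed

section \<open>Nearest points and touching balls\<close>

lemma add_le_dist_if_balls_disjoint:
  fixes x y :: "'a::real_normed_vector"
  assumes "ball x r \<inter> ball y s = {}" "r > 0" "s > 0"
  shows "r + s \<le> dist x y"
proof (rule ccontr)
  assume less: "\<not> r + s \<le> dist x y"
  define w where "w = x + (r / (r + s)) *\<^sub>R (y - x)"
  have "dist x w = r / (r + s) * dist x y"
    using assms by (simp add: w_def dist_norm norm_minus_commute)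
  also have "\<dots> < r / (r + s) * (r + s)"
    using less assms by (intro mult_strict_left_mono) auto
  finally have 1: "w \<in> ball x r" using assms by simp
  have "y - w = (1 - r / (r + s)) *\<^sub>R (y - x)"
    by (simp add: w_def algebra_simps)
  also have "1 - r / (r + s) = s / (r + s)"
    using assms by (simp add: field_simps)
  finally have "dist y w = s / (r + s) * dist x y"
    using assms by (simp add: dist_norm norm_minus_commute)
  also have "\<dots> < s / (r + s) * (r + s)"
    using less assms by (intro mult_strict_left_mono) auto
  finally have 2: "w \<in> ball y s" using assms by simp
  show False using 1 2 assms(1) by blast
qed

lemma infdist_eq_iff_ball_disjoint:
  assumes "a \<in> A" "dist x a = s"
  shows "infdist x A = s \<longleftrightarrow> ball x s \<inter> A = {}"
proof
  assume eq: "infdist x A = s"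
  show "ball x s \<inter> A = {}"
  proof (rule ccontr)
    assume "ball x s \<inter> A \<noteq> {}"
    then obtain b where "b \<in> A" "dist x b < s" by auto
    then show False using infdist_le[of b A x] eq by simp
  qed
next
  assume disj: "ball x s \<inter> A = {}"
  have "s \<le> infdist x A"
    using assms disj by (subst infdist_notempty) (auto intro!: cINF_greatest simp: disjoint_iff not_less)
  then show "infdist x A = s"
    using infdist_le[OF assms(1), of x] assms(2) by simp
qed

text \<open>
  The condition on \<open>r\<close> in the definition of reach, for real \<open>r\<close>.
\<close>

definition unique_proj_below :: "real \<Rightarrow> 'a::metric_space set \<Rightarrow> bool" where
  "unique_proj_below r A \<longleftrightarrow>
     (\<forall>x. infdist x A < r \<longrightarrow> (\<exists>!a. a \<in> A \<and> dist x a = infdist x A))"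

lemma reach_pos_imp_unique_proj:
  assumes "reach A > 0"
  shows "\<exists>r>0. unique_proj_below r A"
proof -
  obtain r where r: "r > 0"
      "\<forall>x. ennreal (infdist x A) < r \<longrightarrow> (\<exists>!a. a \<in> A \<and> dist x a = infdist x A)"
    using assms unfolding reach_def less_Sup_iff by auto
  obtain s where s: "s > 0" "ennreal s \<le> r"
  proof (cases r)
    case (real s)
    then show ?thesis using r that[of s] by auto
  next
    case top
    then show ?thesis using that[of 1] by simp
  qed
  have "unique_proj_below s A"
    unfolding unique_proj_below_def
  proof safe
    fix x assume "infdist x A < s"
    then have "ennreal (infdist x A) < ennreal s"
      by (simp add: ennreal_less_iff infdist_nonneg)
    then have "ennreal (infdist x A) < r" using s(2) by (rule less_le_trans)
    then have ex1: "\<exists>!a. a \<in> A \<and> dist x a = infdist x A" using r by blast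
    then show "\<exists>a. a \<in> A \<and> dist x a = infdist x A" by blast
    fix a b assume "a \<in> A" "dist x a = infdist x A" "b \<in> A" "dist x b = infdist x A"
    then show "a = b" using ex1 by blast
  qed
  then show ?thesis using s(1) by blast
qed

lemma continuous_on_nearest_point:
  fixes A :: "'a::euclidean_space set"
  assumes A: "closed A" "unique_proj_below r A"
    and K: "compact K" "\<And>x. x \<in> K \<Longrightarrow> infdist x A < r"
    and p: "\<And>x. x \<in> K \<Longrightarrow> p x \<in> A \<and> dist x (p x) = infdist x A"
  shows "continuous_on K p"
proof -
  obtain B where B: "\<And>x. x \<in> K \<Longrightarrow> norm x \<le> B"
    using compact_imp_bounded[OF K(1)] unfolding bounded_iff by auto
  have pB: "p x \<in> cball 0 (B + r)" if "x \<in> K" for x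
  proof -
    have "norm (p x) \<le> norm x + dist x (p x)"
      by (metis add.commute dist_norm norm_minus_commute norm_triangle_sub)
    also have "\<dots> \<le> B + r" using B[OF that] p[OF that] K(2)[OF that] by simp
    finally show ?thesis by simp
  qed
  have eq: "(\<lambda>x. (x, p x)) ` K = {z. fst z \<in> K \<and> snd z \<in> A \<and> dist (fst z) (snd z) = infdist (fst z) A}"
  proof -
    have "b = p x" if "x \<in> K" "b \<in> A" "dist x b = infdist x A" for x b
      using A(2) K(2)[OF that(1)] p[OF that(1)] that unfolding unique_proj_below_def by blast
    then show ?thesis using p by force
  qed
  have "closed ((fst -` K \<inter> snd -` A) \<inter> {z. dist (fst z) (snd z) = infdist (fst z) A} :: ('a \<times> 'a) set)"
    using A(1) compact_imp_closed[OF K(1)]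
    by (intro closed_Int closed_vimage closed_Collect_eq continuous_intros) auto
  also have "(fst -` K \<inter> snd -` A) \<inter> {z. dist (fst z) (snd z) = infdist (fst z) A} = (\<lambda>x. (x, p x)) ` K"
    unfolding eq by auto
  finally have "closed ((\<lambda>x. (x, p x)) ` K)" .
  then show ?thesis
    by (intro continuous_from_closed_graph[of "cball 0 (B + r)"]) (use pB in auto)
qed

text \<open>
  Nearest points persist a little further along the ray that leaves \<open>a\<close> through \<open>x = a + s v\<close>. One
  looks for a point \<open>y\<close> at distance \<open>e\<close> from \<open>x\<close> such that \<open>x\<close> lies between \<open>y\<close> and its nearest point: then
  that point is also nearest to \<open>x\<close>, so it is \<open>a\<close>, and \<open>y\<close> lies on the ray beyond \<open>x\<close>. Such a \<open>y\<close> is a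
  fixed point of the map that sends \<open>y\<close> to the point at distance \<open>e\<close> from \<open>x\<close> in the direction opposite
  to the nearest point of \<open>y\<close>.
\<close>

lemma nearest_point_ray_step:
  fixes A :: "'a::euclidean_space set"
  assumes A: "closed A" "unique_proj_below r A"
    and a: "a \<in> A" and v: "norm v = 1" and s: "0 < s" "s < r"
    and near: "infdist (a + s *\<^sub>R v) A = s"
  shows "\<exists>s'>s. s' < r \<and> infdist (a + s' *\<^sub>R v) A = s'"
proof -
  define x where "x = a + s *\<^sub>R v"
  have dx: "dist x a = s" using v s by (simp add: x_def dist_norm)
  define e where "e = (r - s) / 2"
  have e: "e > 0" "s + e < r" using s by (simp_all add: e_def field_simps)
  have small: "infdist y A < r" if "y \<in> cball x e" for y
    using infdist_triangle[of y A x] that near e by (simp add: x_def dist_commute)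
  obtain p where p: "\<And>y. y \<in> cball x e \<Longrightarrow> p y \<in> A \<and> dist y (p y) = infdist y A"
  proof -
    have "\<exists>b. b \<in> A \<and> dist y b = infdist y A" for y
      using infdist_attains_inf[OF A(1), of y] a by (metis empty_iff)
    then show ?thesis using that by metis
  qed
  have contp: "continuous_on (cball x e) p"
    using continuous_on_nearest_point[OF A compact_cball small p] by blast
  have xA: "x \<notin> A" using near s by (auto simp: x_def)
  define g where "g = (\<lambda>y. x + (e / norm (x - p y)) *\<^sub>R (x - p y))"
  have nz: "x - p y \<noteq> 0" if "y \<in> cball x e" for y
    using p[OF that] xA by auto
  have "continuous_on (cball x e) g"
    unfolding g_def using nz by (intro continuous_intros contp) auto
  moreover have "g \<in> cball x e \<rightarrow> cball x e"
    using nz e by (auto simp: g_def dist_norm)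
  ultimately obtain y where y: "y \<in> cball x e" "g y = y"
    using brouwer_ball[OF e(1)] by blast
  define b where "b = p y"
  define l where "l = norm (x - b)"
  have l: "l > 0" using nz[OF y(1)] by (simp add: l_def b_def)
  have yeq: "y = x + (e / l) *\<^sub>R (x - b)"
    using y(2) by (simp add: g_def b_def l_def)
  have "y - b = (1 + e / l) *\<^sub>R (x - b)"
    by (simp add: yeq algebra_simps)
  then have "dist y b = (1 + e / l) * l"
    using l e by (simp add: dist_norm l_def)
  also have "\<dots> = l + e" using l by (simp add: distrib_right)
  finally have dyb: "dist y b = l + e" .
  have bA: "b \<in> A" "dist y b = infdist y A" using p[OF y(1)] by (auto simp: b_def)
  \<comment> \<open>\<open>x\<close> lies between \<open>y\<close> and \<open>b\<close>, so the nearest point of \<open>y\<close> is also nearest to \<open>x\<close>.\<close>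
  have "infdist y A \<le> infdist x A + e"
    using infdist_triangle[of y A x] y(1) by (simp add: dist_commute)
  then have "dist x b \<le> infdist x A" using bA dyb by (simp add: l_def dist_norm)
  then have xb: "dist x b = infdist x A" using infdist_le[OF bA(1), of x] by simp
  have "infdist x A < r" using near s by (simp add: x_def)
  then have ba: "b = a"
    using A(2) bA(1) xb a dx near unfolding unique_proj_below_def by (metis x_def)
  have ls: "l = s" using ba dx by (simp add: l_def dist_norm)
  have "y = a + (s + e) *\<^sub>R v"
    using s by (simp add: yeq ls ba x_def algebra_simps)
  then have "infdist (a + (s + e) *\<^sub>R v) A = s + e"
    using bA(2) dyb ls by simp
  then show ?thesis using e by (intro exI[of _ "s + e"]) auto
qed

text \<open>
  The parameters \<open>s\<close> for which \<open>a\<close> is nearest to \<open>a + s v\<close> form a closed set, which contains all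
  smaller nonnegative parameters with each of its elements. By the previous lemma its supremum cannot lie
  below \<open>\<rho>\<close>.
\<close>

lemma nearest_point_ray_extends:
  fixes A :: "'a::euclidean_space set"
  assumes A: "closed A" "unique_proj_below r A"
    and a: "a \<in> A" and v: "norm v = 1" and s0: "0 < s0"
    and near: "infdist (a + s0 *\<^sub>R v) A = s0" and \<rho>: "0 < \<rho>" "\<rho> < r"
  shows "ball (a + \<rho> *\<^sub>R v) \<rho> \<inter> A = {}"
proof -
  have shrink: "infdist (a + s *\<^sub>R v) A = s" if "0 \<le> s" "s \<le> t" "infdist (a + t *\<^sub>R v) A = t" for s t
  proof -
    have "infdist (a + t *\<^sub>R v) A \<le> infdist (a + s *\<^sub>R v) A + dist (a + t *\<^sub>R v) (a + s *\<^sub>R v)"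
      by (rule infdist_triangle)
    also have "dist (a + t *\<^sub>R v) (a + s *\<^sub>R v) = t - s"
      using v that by (simp add: dist_norm scaleR_left_diff_distrib[symmetric])
    finally have "s \<le> infdist (a + s *\<^sub>R v) A" using that by simp
    moreover have "infdist (a + s *\<^sub>R v) A \<le> s"
      using infdist_le[OF a, of "a + s *\<^sub>R v"] v that by (simp add: dist_norm)
    ultimately show ?thesis by simp
  qed
  define Q where "Q = {s. 0 \<le> s \<and> s \<le> \<rho> \<and> infdist (a + s *\<^sub>R v) A = s}"
  have "closed ({0..\<rho>} \<inter> {s. infdist (a + s *\<^sub>R v) A = s})"
    by (intro closed_Int closed_Collect_eq continuous_intros)
  then have clQ: "closed Q" by (simp add: Q_def Int_def conj_assoc)
  have inQ: "min s0 \<rho> \<in> Q" using shrink[of "min s0 \<rho>" s0] s0 near \<rho> by (simp add: Q_def)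
  have bdd: "bdd_above Q" by (auto simp: Q_def bdd_above_def)
  define \<tau> where "\<tau> = Sup Q"
  have \<tau>: "\<tau> \<in> Q" unfolding \<tau>_def
    using closed_contains_Sup[OF _ bdd clQ] inQ by blast
  have "\<tau> \<ge> min s0 \<rho>" unfolding \<tau>_def using cSup_upper[OF inQ bdd] .
  then have \<tau>0: "\<tau> > 0" using s0 \<rho> by auto
  have "\<tau> = \<rho>"
  proof (rule ccontr)
    assume ne: "\<tau> \<noteq> \<rho>"
    then have "\<tau> < \<rho>" using \<tau> by (auto simp: Q_def)
    then obtain s' where s': "s' > \<tau>" "infdist (a + s' *\<^sub>R v) A = s'"
      using nearest_point_ray_step[OF A a v \<tau>0] \<rho> \<tau> by (auto simp: Q_def)
    have "min s' \<rho> \<in> Q" using shrink[of "min s' \<rho>" s'] s' \<tau>0 \<rho> by (auto simp: Q_def)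
    then have "min s' \<rho> \<le> \<tau>" unfolding \<tau>_def using bdd by (rule cSup_upper)
    then show False using s' \<open>\<tau> < \<rho>\<close> by auto
  qed
  then have "infdist (a + \<rho> *\<^sub>R v) A = \<rho>" using \<tau> by (auto simp: Q_def)
  then show ?thesis
    using infdist_eq_iff_ball_disjoint[OF a, of "a + \<rho> *\<^sub>R v" \<rho>] v \<rho> by (simp add: dist_norm)
qed

text \<open>
  Points outside \<open>A\<close> that converge to \<open>t\<close> have nearest points that also converge to \<open>t\<close>. By the
  previous lemma balls of the fixed radius \<open>\<rho>\<close> touch \<open>A\<close> there, and a limit of their directions exists by
  compactness of the sphere.
\<close>

lemma touching_ball_if_unique_proj:
  fixes A :: "'a::euclidean_space set"
  assumes A: "closed A" "unique_proj_below r A" and t: "t \<in> frontier A" and \<rho>: "0 < \<rho>" "\<rho> < r"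
  shows "\<exists>v. norm v = 1 \<and> ball (t + \<rho> *\<^sub>R v) \<rho> \<inter> A = {}"
proof -
  have tA: "t \<in> A" using A(1) t by (auto simp: frontier_def)
  have "\<exists>x. x \<notin> A \<and> dist t x < 1 / real (Suc n)" for n
    using t unfolding frontier_straddle by (metis of_nat_0_less_iff zero_less_Suc zero_less_divide_1_iff)
  then obtain x where x: "\<And>n. x n \<notin> A" "\<And>n. dist t (x n) < 1 / real (Suc n)" by metis
  have "\<exists>a. a \<in> A \<and> infdist (x n) A = dist (x n) a" for n
    using infdist_attains_inf[OF A(1), of "x n"] tA by (metis empty_iff)
  then obtain a where a: "\<And>n. a n \<in> A" "\<And>n. infdist (x n) A = dist (x n) (a n)" by metis
  define v where "v = (\<lambda>n. (1 / dist (x n) (a n)) *\<^sub>R (x n - a n))"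
  have dpos: "dist (x n) (a n) > 0" for n using x(1) a(1) by (metis zero_less_dist_iff)
  have nv: "norm (v n) = 1" for n using dpos[of n] by (simp add: v_def dist_norm)
  have touch: "ball (a n + \<rho> *\<^sub>R v n) \<rho> \<inter> A = {}" for n
  proof (rule nearest_point_ray_extends[OF A a(1) nv dpos])
    have "a n + dist (x n) (a n) *\<^sub>R v n = x n" using dpos[of n] by (simp add: v_def)
    then show "infdist (a n + dist (x n) (a n) *\<^sub>R v n) A = dist (x n) (a n)" using a(2) by simp
  qed (use \<rho> in auto)
  have at: "dist (a n) t \<le> 2 / real (Suc n)" for n
  proof -
    have "dist (x n) (a n) \<le> dist (x n) t" using infdist_le[OF tA, of "x n"] a(2) by simp
    then have "dist (a n) t \<le> 2 * dist t (x n)"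
      using dist_triangle[of "a n" t "x n"] by (simp add: dist_commute)
    also have "\<dots> \<le> 2 * (1 / real (Suc n))"
      using x(2)[of n] by (intro mult_left_mono) auto
    finally show ?thesis by simp
  qed
  have alim: "a \<longlonglongrightarrow> t"
  proof (rule metric_LIMSEQ_I)
    fix e :: real assume "e > 0"
    then obtain N where N: "2 / e < real N" using reals_Archimedean2 by blast
    have "dist (a n) t < e" if "n \<ge> N" for n
    proof -
      have "2 / e < real (Suc n)" using N that by simp
      then have "2 / real (Suc n) < e" using \<open>e > 0\<close> by (simp add: field_simps)
      then show ?thesis using at[of n] by simp
    qed
    then show "\<exists>no. \<forall>n\<ge>no. dist (a n) t < e" by blast
  qed
  have "v n \<in> sphere 0 1" for n using nv by simp
  then obtain w \<sigma> where w: "w \<in> sphere 0 1" "strict_mono \<sigma>" "(v \<circ> \<sigma>) \<longlonglongrightarrow> w"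
    using compact_sphere[of "0::'a" 1] unfolding compact_def by blast
  have as: "(\<lambda>n. a (\<sigma> n)) \<longlonglongrightarrow> t" using LIMSEQ_subseq_LIMSEQ[OF alim w(2)] by (simp add: o_def)
  have "ball (t + \<rho> *\<^sub>R w) \<rho> \<inter> A = {}"
  proof (rule ccontr)
    assume "ball (t + \<rho> *\<^sub>R w) \<rho> \<inter> A \<noteq> {}"
    then obtain b where b: "b \<in> A" "dist (t + \<rho> *\<^sub>R w) b < \<rho>" by auto
    have "(\<lambda>n. dist (a (\<sigma> n) + \<rho> *\<^sub>R v (\<sigma> n)) b) \<longlonglongrightarrow> dist (t + \<rho> *\<^sub>R w) b"
      using w(3) by (intro tendsto_intros as) (simp add: o_def)
    moreover have "\<rho> \<le> dist (a (\<sigma> n) + \<rho> *\<^sub>R v (\<sigma> n)) b" for n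
      using touch[of "\<sigma> n"] b(1) by (meson disjoint_iff mem_ball not_le)
    ultimately have "\<rho> \<le> dist (t + \<rho> *\<^sub>R w) b"
      by (intro LIMSEQ_le_const) auto
    then show False using b by simp
  qed
  then show ?thesis using w(1) by auto
qed

section \<open>Boundaries touched by balls from both sides\<close>

text \<open>
  \<open>\<nu> t\<close> is the outer unit normal at \<open>t\<close>, witnessed by balls of radius \<open>\<rho>\<close> that touch at \<open>t\<close> from both
  sides.
\<close>

definition two_sided_normal :: "real \<Rightarrow> 'a::real_inner set \<Rightarrow> ('a \<Rightarrow> 'a) \<Rightarrow> bool" where
  "two_sided_normal \<rho> G \<nu> \<longleftrightarrow>
     (\<forall>t\<in>frontier G. norm (\<nu> t) = 1 \<and> ball (t + \<rho> *\<^sub>R \<nu> t) \<rho> \<inter> G = {} \<and> ball (t - \<rho> *\<^sub>R \<nu> t) \<rho> \<subseteq> G)"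

text \<open>
  The outer ball at each of the points \<open>s\<close>, \<open>t\<close> is disjoint from the inner ball at the other one,
  so their centres are at distance at least \<open>2\<rho>\<close>. The sum of the two squared inequalities is the claim, by
  the parallelogram law.
\<close>

lemma two_sided_normal_lipschitz:
  assumes \<rho>: "\<rho> > 0" and N: "two_sided_normal \<rho> G \<nu>" and st: "s \<in> frontier G" "t \<in> frontier G"
  shows "dist (\<nu> s) (\<nu> t) \<le> dist s t / \<rho>"
proof -
  have far: "2 * \<rho> \<le> norm (b - a + \<rho> *\<^sub>R (\<nu> a + \<nu> b))" if "a \<in> frontier G" "b \<in> frontier G" for a b
  proof -
    have "ball (b + \<rho> *\<^sub>R \<nu> b) \<rho> \<inter> ball (a - \<rho> *\<^sub>R \<nu> a) \<rho> = {}"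
      using N that unfolding two_sided_normal_def by blast
    then have "\<rho> + \<rho> \<le> dist (b + \<rho> *\<^sub>R \<nu> b) (a - \<rho> *\<^sub>R \<nu> a)"
      using \<rho> by (intro add_le_dist_if_balls_disjoint) auto
    then show ?thesis by (simp add: dist_norm algebra_simps)
  qed
  have unit: "\<nu> s \<bullet> \<nu> s = 1" "\<nu> t \<bullet> \<nu> t = 1"
    using N st by (auto simp: two_sided_normal_def norm_eq_1)
  define c where "c = \<nu> s \<bullet> \<nu> t"
  define u where "u = t - s"
  define w where "w = \<rho> *\<^sub>R (\<nu> s + \<nu> t)"
  have "(2 * \<rho>)\<^sup>2 \<le> (norm (u + w))\<^sup>2" "(2 * \<rho>)\<^sup>2 \<le> (norm (- u + w))\<^sup>2"
  proof -
    have "2 * \<rho> \<le> norm (u + w)" "2 * \<rho> \<le> norm (- u + w)"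
      using far[OF st] far[OF st(2,1)] by (simp_all add: u_def w_def add.commute)
    then show "(2 * \<rho>)\<^sup>2 \<le> (norm (u + w))\<^sup>2" "(2 * \<rho>)\<^sup>2 \<le> (norm (- u + w))\<^sup>2"
      using \<rho> by (intro power_mono; simp)+
  qed
  then have "8 * \<rho>\<^sup>2 \<le> 2 * (u \<bullet> u) + 2 * (w \<bullet> w)"
    unfolding power2_norm_eq_inner
    by (simp add: inner_add_left inner_add_right inner_diff_left inner_diff_right inner_commute power2_eq_square)
  moreover have "w \<bullet> w = \<rho>\<^sup>2 * (2 + 2 * c)"
    using unit by (simp add: w_def c_def inner_add_left inner_add_right inner_commute power2_eq_square algebra_simps)
  ultimately have "\<rho>\<^sup>2 * (2 - 2 * c) \<le> u \<bullet> u" by (simp add: algebra_simps)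
  moreover have "(norm (\<nu> s - \<nu> t))\<^sup>2 = 2 - 2 * c"
    unfolding power2_norm_eq_inner using unit by (simp add: c_def inner_diff_left inner_diff_right inner_commute)
  ultimately have "(\<rho> * norm (\<nu> s - \<nu> t))\<^sup>2 \<le> (norm (s - t))\<^sup>2"
    by (simp add: power_mult_distrib u_def dot_square_norm norm_minus_commute)
  then have "\<rho> * norm (\<nu> s - \<nu> t) \<le> norm (s - t)" by (rule power2_le_imp_le) simp
  then show ?thesis using \<rho> by (simp add: dist_norm field_simps)
qed

text \<open>
  The boundary point \<open>s\<close> lies in neither of the two balls that touch at \<open>t\<close>, hence close to the
  tangent plane at \<open>t\<close>.
\<close>

lemma two_sided_normal_almost_orthogonal:
  fixes G :: "'a::real_inner set"
  assumes \<rho>: "\<rho> > 0" and N: "two_sided_normal \<rho> G \<nu>" and G: "closed G"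
    and st: "s \<in> frontier G" "t \<in> frontier G"
  shows "\<bar>\<nu> t \<bullet> (s - t)\<bar> \<le> (norm (s - t))\<^sup>2 / (2 * \<rho>)"
proof -
  have unit: "\<nu> t \<bullet> \<nu> t = 1"
    using N st by (auto simp: two_sided_normal_def norm_eq_1)
  have "s \<in> G" using st G by (auto simp: frontier_def)
  then have "s \<notin> ball (t + \<rho> *\<^sub>R \<nu> t) \<rho>" using N st unfolding two_sided_normal_def by blast
  moreover have "s \<notin> ball (t - \<rho> *\<^sub>R \<nu> t) \<rho>"
  proof -
    have "ball (t - \<rho> *\<^sub>R \<nu> t) \<rho> \<subseteq> interior G"
      using N st unfolding two_sided_normal_def by (intro interior_maximal) auto
    then show ?thesis using st by (auto simp: frontier_def)
  qed
  ultimately have "\<rho> \<le> norm (s - t - \<rho> *\<^sub>R \<nu> t)" "\<rho> \<le> norm (s - t + \<rho> *\<^sub>R \<nu> t)"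
    by (auto simp: dist_norm norm_minus_commute algebra_simps)
  then have "\<rho>\<^sup>2 \<le> (norm (s - t - \<rho> *\<^sub>R \<nu> t))\<^sup>2" "\<rho>\<^sup>2 \<le> (norm (s - t + \<rho> *\<^sub>R \<nu> t))\<^sup>2"
    using \<rho> by (auto intro!: power_mono)
  moreover define u where "u = s - t"
  ultimately have "\<rho>\<^sup>2 \<le> (u - \<rho> *\<^sub>R \<nu> t) \<bullet> (u - \<rho> *\<^sub>R \<nu> t)" "\<rho>\<^sup>2 \<le> (u + \<rho> *\<^sub>R \<nu> t) \<bullet> (u + \<rho> *\<^sub>R \<nu> t)"
    unfolding power2_norm_eq_inner by auto
  then have "2 * \<rho> * \<bar>\<nu> t \<bullet> u\<bar> \<le> u \<bullet> u"
    using \<rho> unit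
    by (auto simp: inner_add_left inner_add_right inner_diff_left inner_diff_right inner_commute
        power2_eq_square abs_if algebra_simps)
  then show ?thesis using \<rho> by (simp add: u_def power2_norm_eq_inner field_simps)
qed

text \<open>
  Take the inner product of the difference of the two points with \<open>t - t'\<close>: by almost orthogonality
  the normal components contribute at most half of the squared distance of \<open>t\<close> and \<open>t'\<close>, as both heights
  are at most \<open>\<rho> / 2\<close>.
\<close>

lemma two_sided_normal_foot_lipschitz:
  fixes G :: "'a::real_inner set"
  assumes \<rho>: "\<rho> > 0" and N: "two_sided_normal \<rho> G \<nu>" and G: "closed G"
    and t: "t \<in> frontier G" "t' \<in> frontier G" and s: "\<bar>s\<bar> \<le> \<rho> / 2" "\<bar>s'\<bar> \<le> \<rho> / 2"
  shows "dist t t' \<le> 2 * dist (t + s *\<^sub>R \<nu> t) (t' + s' *\<^sub>R \<nu> t')"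
proof -
  define u where "u = t - t'"
  define z where "z = (t + s *\<^sub>R \<nu> t) - (t' + s' *\<^sub>R \<nu> t')"
  have small: "\<bar>a * x\<bar> \<le> (norm u)\<^sup>2 / 4" if "\<bar>a\<bar> \<le> \<rho> / 2" "\<bar>x\<bar> \<le> (norm u)\<^sup>2 / (2 * \<rho>)" for a x
  proof -
    have "\<bar>a * x\<bar> \<le> \<rho> / 2 * ((norm u)\<^sup>2 / (2 * \<rho>))"
      unfolding abs_mult using that \<rho> by (intro mult_mono) auto
    then show ?thesis using \<rho> by simp
  qed
  have "\<bar>\<nu> t \<bullet> u\<bar> \<le> (norm u)\<^sup>2 / (2 * \<rho>)"
    using two_sided_normal_almost_orthogonal[OF \<rho> N G t(2,1)]
    by (metis abs_minus_cancel inner_minus_right minus_diff_eq norm_minus_commute u_def)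
  moreover have "\<bar>\<nu> t' \<bullet> u\<bar> \<le> (norm u)\<^sup>2 / (2 * \<rho>)"
    using two_sided_normal_almost_orthogonal[OF \<rho> N G t] by (simp add: u_def)
  ultimately have "\<bar>s * (\<nu> t \<bullet> u)\<bar> \<le> (norm u)\<^sup>2 / 4" "\<bar>s' * (\<nu> t' \<bullet> u)\<bar> \<le> (norm u)\<^sup>2 / 4"
    using small s by auto
  moreover have "z \<bullet> u = (norm u)\<^sup>2 + s * (\<nu> t \<bullet> u) - s' * (\<nu> t' \<bullet> u)"
    unfolding power2_norm_eq_inner by (simp add: z_def u_def algebra_simps)
  ultimately have "(norm u)\<^sup>2 / 2 \<le> z \<bullet> u" by linarith
  also have "\<dots> \<le> norm z * norm u" by (rule norm_cauchy_schwarz)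
  finally have "norm u * norm u \<le> 2 * norm z * norm u" by (simp add: power2_eq_square)
  then have "norm u \<le> 2 * norm z"
    by (cases "norm u = 0") (auto simp: mult_le_cancel_right)
  then show ?thesis by (simp add: u_def z_def dist_norm)
qed

definition shell :: "'a::real_normed_vector set \<Rightarrow> ('a \<Rightarrow> 'a) \<Rightarrow> real \<Rightarrow> real \<Rightarrow> 'a set" where
  "shell T \<nu> a b = (\<lambda>(t, s). t + s *\<^sub>R \<nu> t) ` (T \<times> {a..b})"

lemma shell_shift: "shell T \<nu> (a + h) (b + h) = (\<lambda>(t, s). t + (s + h) *\<^sub>R \<nu> t) ` (T \<times> {a..b})"
proof -
  have "(\<lambda>(t, s). t + (s + h) *\<^sub>R \<nu> t) ` (T \<times> {a..b})
      = (\<lambda>(t, s). t + s *\<^sub>R \<nu> t) ` ((\<lambda>(t, s). (t, s + h)) ` (T \<times> {a..b}))"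
    by (simp add: image_image split_beta)
  also have "(\<lambda>(t, s). (t, s + h)) ` (T \<times> {a..b}) = T \<times> (\<lambda>s. s + h) ` {a..b}"
    using map_prod_surj_on[of id T T "\<lambda>s. s + h" "{a..b}" "(\<lambda>s. s + h) ` {a..b}"]
    by (simp add: map_prod_def)
  also have "(\<lambda>s. s + h) ` {a..b} = {a + h..b + h}" by simp
  finally show ?thesis by (simp add: shell_def)
qed

lemma compact_shell:
  fixes G :: "'a::real_inner set"
  assumes "\<rho> > 0" "two_sided_normal \<rho> G \<nu>" "compact (frontier G)"
  shows "compact (shell (frontier G) \<nu> a b)"
  unfolding shell_def
proof (rule compact_continuous_image)
  have cont: "continuous_on (frontier G) \<nu>"
    by (rule lipschitz_on_continuous_on[of "1 / \<rho>"], rule lipschitz_onI)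
       (use two_sided_normal_lipschitz[OF assms(1,2)] assms(1) in auto)
  have "continuous_on (frontier G \<times> {a..b}) (\<lambda>x. \<nu> (fst x))"
    by (rule continuous_on_compose2[OF cont]) (auto intro!: continuous_intros)
  then show "continuous_on (frontier G \<times> {a..b}) (\<lambda>(t, s). t + s *\<^sub>R \<nu> t)"
    by (auto simp: split_beta intro!: continuous_intros)
qed (use assms in \<open>auto intro: compact_Times\<close>)

text \<open>
  Let \<open>t\<close> be nearest to \<open>z\<close>, at distance \<open>\<sigma>\<close>. The ball of radius \<open>\<sigma>\<close> around \<open>z\<close> does not meet the
  boundary, so it lies on one side and is disjoint from the touching ball of radius \<open>\<rho>\<close> on the other side.
  Then the two centres are at distance \<open>\<sigma> + \<rho>\<close>, with \<open>t\<close> between them, and \<open>z\<close> lies on the normal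
  at \<open>t\<close>.
\<close>

lemma ball_nbhd_eq_shell:
  fixes G :: "'a::euclidean_space set"
  assumes \<rho>: "\<rho> > 0" and N: "two_sided_normal \<rho> G \<nu>" and G: "compact G" and e: "e \<ge> 0"
  shows "ball_nbhd (frontier G) e = shell (frontier G) \<nu> (- e) e"
proof
  show "shell (frontier G) \<nu> (- e) e \<subseteq> ball_nbhd (frontier G) e"
    using N by (fastforce simp: shell_def ball_nbhd_def two_sided_normal_def dist_norm)
next
  show "ball_nbhd (frontier G) e \<subseteq> shell (frontier G) \<nu> (- e) e"
  proof
    fix z assume z: "z \<in> ball_nbhd (frontier G) e"
    then obtain t0 where t0: "t0 \<in> frontier G" "dist t0 z \<le> e" by (auto simp: ball_nbhd_def)
    obtain t where t: "t \<in> frontier G" "infdist z (frontier G) = dist z t"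
      using infdist_attains_inf[of "frontier G" z] t0 by (metis empty_iff frontier_closed)
    define \<sigma> where "\<sigma> = dist z t"
    have \<sigma>e: "\<sigma> \<le> e" using t t0 infdist_le[OF t0(1), of z] by (simp add: \<sigma>_def dist_commute)
    have norm\<nu>: "norm (\<nu> t) = 1" "\<nu> t \<bullet> \<nu> t = 1" using N t by (auto simp: two_sided_normal_def norm_eq_1)
    \<comment> \<open>The sign \<open>c\<close> tells on which side of the boundary \<open>z\<close> lies.\<close>
    have touch: "z = t + (c * \<sigma>) *\<^sub>R \<nu> t"
      if c: "\<bar>c\<bar> = 1" and disj: "ball z \<sigma> \<inter> ball (t - (c * \<rho>) *\<^sub>R \<nu> t) \<rho> = {}" and pos: "\<sigma> > 0" for c
    proof -
      have cc: "c * c = 1" using c by (metis abs_mult_self_eq mult_1)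
      have "\<sigma> + \<rho> \<le> dist z (t - (c * \<rho>) *\<^sub>R \<nu> t)"
        using add_le_dist_if_balls_disjoint[OF disj pos \<rho>] .
      then have "(\<sigma> + \<rho>)\<^sup>2 \<le> (norm (z - t + (c * \<rho>) *\<^sub>R \<nu> t))\<^sup>2"
        using pos \<rho> by (intro power_mono) (auto simp: dist_norm algebra_simps)
      moreover define u where "u = z - t"
      moreover have "u \<bullet> u = \<sigma>\<^sup>2" by (simp add: u_def \<sigma>_def dist_norm power2_norm_eq_inner)
      moreover have "(c * \<rho>) * (c * \<rho>) = \<rho>\<^sup>2" using cc by (simp add: power2_eq_square algebra_simps)
      ultimately have "\<sigma>\<^sup>2 + 2 * \<sigma> * \<rho> + \<rho>\<^sup>2 \<le> \<sigma>\<^sup>2 + 2 * (c * (\<rho> * (u \<bullet> \<nu> t))) + \<rho>\<^sup>2"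
        unfolding power2_norm_eq_inner using norm\<nu>(2)
        by (simp add: inner_add_left inner_add_right inner_commute power2_sum mult.commute mult.left_commute)
      then have "\<rho> * \<sigma> \<le> \<rho> * (c * (u \<bullet> \<nu> t))" by (simp add: mult.commute mult.left_commute)
      then have ge: "\<sigma> \<le> c * (u \<bullet> \<nu> t)" using \<rho> by simp
      have "(norm (u - (c * \<sigma>) *\<^sub>R \<nu> t))\<^sup>2 = u \<bullet> u - 2 * \<sigma> * (c * (u \<bullet> \<nu> t)) + (c * c) * \<sigma>\<^sup>2"
        unfolding power2_norm_eq_inner using norm\<nu>(2)
        by (simp add: inner_diff_left inner_diff_right inner_commute power2_eq_square algebra_simps)
      also have "\<dots> \<le> 2 * \<sigma>\<^sup>2 - 2 * \<sigma> * \<sigma>"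
        using mult_left_mono[OF ge, of "2 * \<sigma>"] pos cc \<open>u \<bullet> u = \<sigma>\<^sup>2\<close> by simp
      also have "\<dots> = 0" by (simp add: power2_eq_square)
      finally have "u = (c * \<sigma>) *\<^sub>R \<nu> t" by simp
      then show ?thesis by (simp add: u_def algebra_simps)
    qed
    have inshell: "t + s *\<^sub>R \<nu> t \<in> shell (frontier G) \<nu> (- e) e" if "\<bar>s\<bar> \<le> e" for s
      unfolding shell_def using that t(1) by (intro image_eqI[of _ _ "(t, s)"]) (auto simp: abs_le_iff)
    consider "\<sigma> = 0" | "\<sigma> > 0" by (fastforce simp: \<sigma>_def)
    then show "z \<in> shell (frontier G) \<nu> (- e) e"
    proof cases
      case 1
      then show ?thesis using inshell[of 0] e by (simp add: \<sigma>_def)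
    next
      case 2
      have "ball z \<sigma> \<inter> frontier G = {}"
        using infdist_eq_iff_ball_disjoint[OF t(1), of z \<sigma>] t by (simp add: \<sigma>_def)
      then have side: "ball z \<sigma> \<inter> G = {} \<or> ball z \<sigma> \<subseteq> G"
        using connected_Int_frontier[of "ball z \<sigma>" G] by (auto simp: connected_ball)
      then show ?thesis
      proof
        assume "ball z \<sigma> \<inter> G = {}"
        then have "ball z \<sigma> \<inter> ball (t - (1 * \<rho>) *\<^sub>R \<nu> t) \<rho> = {}"
          using N t(1) unfolding two_sided_normal_def mult_1 by blast
        then have "z = t + (1 * \<sigma>) *\<^sub>R \<nu> t" using 2 by (intro touch) auto
        then show ?thesis using inshell[of "1 * \<sigma>"] \<sigma>e 2 by auto
      next
        assume "ball z \<sigma> \<subseteq> G"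
        moreover have "ball (t + \<rho> *\<^sub>R \<nu> t) \<rho> \<inter> G = {}"
          using N t(1) unfolding two_sided_normal_def by blast
        ultimately have "ball z \<sigma> \<inter> ball (t - (- 1 * \<rho>) *\<^sub>R \<nu> t) \<rho> = {}" by auto
        then have "z = t + (- 1 * \<sigma>) *\<^sub>R \<nu> t" using 2 by (intro touch) auto
        then show ?thesis using inshell[of "- 1 * \<sigma>"] \<sigma>e 2 by auto
      qed
    qed
  qed
qed

text \<open>
  Shifting by \<open>h\<close> changes the difference of two points by \<open>h\<close> times the difference of their normals,
  which is at most \<open>2 / \<rho>\<close> times their distance since feet and normals are Lipschitz.
\<close>

lemma measure_shell_shift_le:
  fixes G :: "'a::euclidean_space set"
  assumes \<rho>: "\<rho> > 0" and N: "two_sided_normal \<rho> G \<nu>" and G: "compact G"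
    and ab: "\<bar>a\<bar> \<le> \<rho> / 2" "\<bar>b\<bar> \<le> \<rho> / 2"
  shows "measure lborel (shell (frontier G) \<nu> (a + h) (b + h))
         \<le> (1 + 2 * \<bar>h\<bar> / \<rho>) ^ DIM('a) * measure lborel (shell (frontier G) \<nu> a b)"
proof -
  define p where "p = (\<lambda>(t, s). t + s *\<^sub>R \<nu> t)"
  define q where "q = (\<lambda>(t, s). t + (s + h) *\<^sub>R \<nu> t)"
  let ?I = "frontier G \<times> {a..b}"
  have T: "compact (frontier G)" using G by (rule compact_frontier)
  have pI: "shell (frontier G) \<nu> a b = p ` ?I" by (simp add: shell_def p_def)
  have qI: "shell (frontier G) \<nu> (a + h) (b + h) = q ` ?I" by (simp add: shell_shift q_def)
  show ?thesis
    unfolding pI qI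
  proof (rule measure_lipschitz_reparam_le)
    show "compact (p ` ?I)" "compact (q ` ?I)"
      using compact_shell[OF \<rho> N T] pI qI by metis+
    show "0 \<le> 1 + 2 * \<bar>h\<bar> / \<rho>" using \<rho> by simp
    fix i j assume ij: "i \<in> ?I" "j \<in> ?I"
    obtain t s t' s' where ts: "i = (t, s)" "j = (t', s')" by fastforce
    have t: "t \<in> frontier G" "t' \<in> frontier G" using ij ts by auto
    have s: "\<bar>s\<bar> \<le> \<rho> / 2" "\<bar>s'\<bar> \<le> \<rho> / 2" using ij ts ab by auto
    have "dist (q i) (q j) = norm ((p i - p j) + h *\<^sub>R (\<nu> t - \<nu> t'))"
      by (simp add: p_def q_def ts dist_norm algebra_simps)
    also have "\<dots> \<le> dist (p i) (p j) + \<bar>h\<bar> * dist (\<nu> t) (\<nu> t')"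
      using norm_triangle_ineq[of "p i - p j" "h *\<^sub>R (\<nu> t - \<nu> t')"] by (simp add: dist_norm)
    also have "\<bar>h\<bar> * dist (\<nu> t) (\<nu> t') \<le> \<bar>h\<bar> * (2 * dist (p i) (p j) / \<rho>)"
    proof (intro mult_left_mono)
      have "dist t t' \<le> 2 * dist (p i) (p j)"
        using two_sided_normal_foot_lipschitz[OF \<rho> N _ t s] G by (simp add: p_def ts compact_imp_closed)
      then have "dist t t' / \<rho> \<le> 2 * dist (p i) (p j) / \<rho>" using \<rho> by (simp add: divide_right_mono)
      then show "dist (\<nu> t) (\<nu> t') \<le> 2 * dist (p i) (p j) / \<rho>"
        using two_sided_normal_lipschitz[OF \<rho> N t] by linarith
    qed simp
    finally show "dist (q i) (q j) \<le> (1 + 2 * \<bar>h\<bar> / \<rho>) * dist (p i) (p j)"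
      by (simp add: algebra_simps)
  qed
qed

text \<open>
  The shells of heights \<open>[-2e, 0]\<close> and \<open>[0, 2e]\<close> are shifts of the shell of heights \<open>[-e, e]\<close>. They
  cover the tube of radius \<open>2e\<close> and overlap in the boundary only. Shifting in either direction changes
  volumes at most by the factor \<open>L\<close>, and \<open>1 / L\<close> is at least \<open>2 - L\<close>.
\<close>

lemma tube_volume_doubling:
  fixes G :: "'a::euclidean_space set"
  assumes \<rho>: "\<rho> > 0" and N: "two_sided_normal \<rho> G \<nu>" and G: "compact G"
    and null: "measure lborel (frontier G) = 0" and e: "0 \<le> e" "e \<le> \<rho> / 4"
  shows "\<bar>tube_volume G (2 * e) - 2 * tube_volume G e\<bar>
         \<le> 2 * ((1 + 2 * e / \<rho>) ^ DIM('a) - 1) * tube_volume G e"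
proof -
  let ?T = "frontier G" and ?m = "measure lborel"
  let ?S = "shell ?T \<nu>"
  define L where "L = (1 + 2 * e / \<rho>) ^ DIM('a)"
  have L1: "L \<ge> 1" using e \<rho> by (auto simp: L_def intro!: one_le_power)
  have T: "compact ?T" using G by (rule compact_frontier)
  have fin: "emeasure lborel (?S a b) \<noteq> \<infinity>" "?S a b \<in> sets lborel" for a b
    using compact_shell[OF \<rho> N T] emeasure_compact_finite[of "?S a b"] by (auto intro: borel_compact)
  have F: "tube_volume G e = ?m (?S (- e) e)" "tube_volume G (2 * e) = ?m (?S (- (2 * e)) (2 * e))"
    using ball_nbhd_eq_shell[OF \<rho> N G] e by (auto simp: tube_volume_def)
  have un: "?S (- (2 * e)) (2 * e) = ?S (- (2 * e)) 0 \<union> ?S 0 (2 * e)"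
  proof -
    have "{- (2 * e)..2 * e} = {- (2 * e)..0} \<union> {0..2 * e}" using e by auto
    then show ?thesis by (auto simp: shell_def)
  qed
  have int: "?S (- (2 * e)) 0 \<inter> ?S 0 (2 * e) \<subseteq> ?T"
  proof
    fix z assume "z \<in> ?S (- (2 * e)) 0 \<inter> ?S 0 (2 * e)"
    then obtain t s t' s' where
      z: "t \<in> ?T" "t' \<in> ?T" "z = t + s *\<^sub>R \<nu> t" "z = t' + s' *\<^sub>R \<nu> t'"
      and s: "- (2 * e) \<le> s" "s \<le> 0" "0 \<le> s'" "s' \<le> 2 * e"
    proof -
      obtain i j where "i \<in> ?T \<times> {- (2 * e)..0}" "z = fst i + snd i *\<^sub>R \<nu> (fst i)"
          "j \<in> ?T \<times> {0..2 * e}" "z = fst j + snd j *\<^sub>R \<nu> (fst j)"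
        using \<open>z \<in> _\<close> unfolding shell_def split_beta by blast
      then show ?thesis by (intro that[of "fst i" "fst j" "snd i" "snd j"]) auto
    qed
    have ss: "\<bar>s\<bar> \<le> \<rho> / 2" "\<bar>s'\<bar> \<le> \<rho> / 2" using s e by auto
    have "dist t t' \<le> 2 * dist (t + s *\<^sub>R \<nu> t) (t' + s' *\<^sub>R \<nu> t')"
      by (rule two_sided_normal_foot_lipschitz[OF \<rho> N compact_imp_closed[OF G] z(1,2) ss])
    then have "t = t'" using z by (metis dist_self dist_le_zero_iff mult_zero_right)
    then have "s *\<^sub>R \<nu> t = s' *\<^sub>R \<nu> t" using z(3,4) by (metis add_left_cancel)
    moreover have "\<nu> t \<noteq> 0" using N z(1) by (auto simp: two_sided_normal_def)
    ultimately have "s = s'" by (metis scaleR_cancel_right)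
    then have "s = 0" using s by auto
    then show "z \<in> ?T" using z by simp
  qed
  have "?m (?S (- (2 * e)) 0 \<inter> ?S 0 (2 * e)) \<le> ?m ?T"
  proof (rule measure_mono_fmeasurable[OF int])
    show "?S (- (2 * e)) 0 \<inter> ?S 0 (2 * e) \<in> sets lborel" using fin by blast
    show "?T \<in> fmeasurable lborel"
      using emeasure_compact_finite[OF T] borel_compact[OF T] by (intro fmeasurableI) auto
  qed
  then have int0: "?m (?S (- (2 * e)) 0 \<inter> ?S 0 (2 * e)) = 0" using null by (simp add: measure_le_0_iff)
  have F2: "tube_volume G (2 * e) = ?m (?S (- (2 * e)) 0) + ?m (?S 0 (2 * e))"
  proof -
    have fm: "?S a b \<in> fmeasurable lborel" for a b
      using fin[of a b] by (intro fmeasurableI) (auto simp: less_top)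
    show ?thesis unfolding F(2) un using int0 by (simp add: measure_Un3[OF fm fm])
  qed
  have up: "?m (?S (- (2 * e)) 0) \<le> L * ?m (?S (- e) e)" "?m (?S 0 (2 * e)) \<le> L * ?m (?S (- e) e)"
    using measure_shell_shift_le[OF \<rho> N G, of "- e" e "- e"] measure_shell_shift_le[OF \<rho> N G, of "- e" e e] e \<rho>
    by (auto simp: L_def)
  have down: "?m (?S (- e) e) \<le> L * ?m (?S (- (2 * e)) 0)" "?m (?S (- e) e) \<le> L * ?m (?S 0 (2 * e))"
    using measure_shell_shift_le[OF \<rho> N G, of "- (2 * e)" 0 e]
      measure_shell_shift_le[OF \<rho> N G, of 0 "2 * e" "- e"] e \<rho>
    by (auto simp: L_def)
  have lower: "(2 - L) * y \<le> x" if "y \<le> L * x" "y \<ge> 0" "x \<ge> 0" for x y :: real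
  proof (cases "L \<le> 2")
    case True
    then have "(2 - L) * y \<le> (2 - L) * (L * x)" using that by (intro mult_left_mono) auto
    also have "(2 - L) * L \<le> 1" using zero_le_power2[of "L - 1"] by (simp add: power2_eq_square algebra_simps)
    then have "(2 - L) * (L * x) \<le> x" using that(3) mult_right_mono[of "(2 - L) * L" 1 x] by (simp add: mult.assoc)
    finally show ?thesis .
  next
    case False
    then have "(2 - L) * y \<le> 0" using that by (simp add: mult_nonpos_nonneg)
    then show ?thesis using that by simp
  qed
  have "(2 - L) * ?m (?S (- e) e) \<le> ?m (?S (- (2 * e)) 0)" "(2 - L) * ?m (?S (- e) e) \<le> ?m (?S 0 (2 * e))"
    using down by (auto intro!: lower)
  then show ?thesis using up unfolding F2 unfolding F(1) L_def[symmetric]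
    by (simp add: abs_le_iff algebra_simps)
qed

text \<open>
  The bounds for \<open>e / 2\<close>, \<open>e / 4\<close>, and so on form a geometric series with sum \<open>C * e\<close>.
\<close>

lemma limit_rate_if_doubling:
  fixes g :: "real \<Rightarrow> real"
  assumes lim: "(g \<longlongrightarrow> L) (at_right 0)"
    and step: "\<And>e. 0 < e \<Longrightarrow> e \<le> e0 \<Longrightarrow> \<bar>g (2 * e) - g e\<bar> \<le> C * e"
    and e: "0 < e" "e \<le> e0"
  shows "\<bar>g e - L\<bar> \<le> C * e"
proof -
  have tele: "\<bar>g e - g (e / 2 ^ k)\<bar> \<le> C * e * (1 - 1 / 2 ^ k)" for k
  proof (induction k)
    case (Suc k)
    have "e / 2 ^ Suc k \<le> e0"
    proof -
      have "e * 1 \<le> e * 2 ^ Suc k" using e by (intro mult_left_mono one_le_power) auto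
      then have "e / 2 ^ Suc k \<le> e" by (simp add: divide_le_eq)
      then show ?thesis using e by linarith
    qed
    then have "\<bar>g (2 * (e / 2 ^ Suc k)) - g (e / 2 ^ Suc k)\<bar> \<le> C * (e / 2 ^ Suc k)"
      using e by (intro step) auto
    then have "\<bar>g (e / 2 ^ k) - g (e / 2 ^ Suc k)\<bar> \<le> C * e * (1 / 2 ^ k - 1 / 2 ^ Suc k)"
      by (simp add: field_simps)
    then have "\<bar>g e - g (e / 2 ^ Suc k)\<bar> \<le> C * e * (1 - 1 / 2 ^ k) + C * e * (1 / 2 ^ k - 1 / 2 ^ Suc k)"
      using Suc by linarith
    then show ?case by (simp add: algebra_simps)
  qed auto
  have pw: "(\<lambda>k. 1 / 2 ^ k :: real) \<longlonglongrightarrow> 0"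
    using LIMSEQ_realpow_zero[of "1/2::real"] by (simp add: power_one_over)
  have "filterlim (\<lambda>k. e / 2 ^ k) (at_right 0) sequentially"
    using tendsto_mult_left[OF pw, of e] e by (intro tendsto_imp_filterlim_at_right) auto
  then have "(\<lambda>k. g (e / 2 ^ k)) \<longlonglongrightarrow> L" by (rule filterlim_compose[OF lim])
  then have "(\<lambda>k. \<bar>g e - g (e / 2 ^ k)\<bar>) \<longlonglongrightarrow> \<bar>g e - L\<bar>" by (intro tendsto_intros)
  moreover have "(\<lambda>k. C * e * (1 - 1 / 2 ^ k)) \<longlonglongrightarrow> C * e * (1 - 0)"
    by (intro tendsto_intros pw)
  ultimately show ?thesis using tele by (intro LIMSEQ_le[of "\<lambda>k. \<bar>g e - g (e / 2 ^ k)\<bar>" _ "\<lambda>k. C * e * (1 - 1 / 2 ^ k)"]) auto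
qed

text \<open>
  The chord over \<open>[0, 1]\<close> of the convex function on the left.
\<close>

lemma one_plus_power_le:
  fixes x :: real
  assumes "0 \<le> x" "x \<le> 1"
  shows "(1 + x) ^ d \<le> 1 + (2 ^ d - 1) * x"
proof (induction d)
  case (Suc d)
  have "(1 + x) ^ Suc d \<le> (1 + x) * (1 + (2 ^ d - 1) * x)"
    using Suc assms by (simp add: mult_left_mono)
  also have "\<dots> = 1 + x + (2 ^ d - 1) * x + (2 ^ d - 1) * (x * x)" by (simp add: algebra_simps)
  also have "x * x \<le> x" using assms mult_left_mono[of x 1 x] by simp
  then have "1 + x + (2 ^ d - 1) * x + (2 ^ d - 1) * (x * x) \<le> 1 + x + (2 ^ d - 1) * x + (2 ^ d - 1) * x"
    by (intro add_left_mono mult_left_mono) auto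
  finally show ?case by (simp add: algebra_simps)
qed auto

lemma tube_ratio_rate:
  fixes G :: "'a::euclidean_space set"
  assumes \<rho>: "\<rho> > 0" and N: "two_sided_normal \<rho> G \<nu>" and G: "compact G"
    and null: "measure lborel (frontier G) = 0"
    and lim: "(tube_ratio G \<longlongrightarrow> L0) (at_right 0)"
  shows "\<exists>C e0. C > 0 \<and> e0 > 0 \<and> (\<forall>e. 0 < e \<and> e \<le> e0 \<longrightarrow> \<bar>tube_ratio G e - L0\<bar> \<le> C * e)"
proof -
  have "\<forall>\<^sub>F e in at_right 0. tube_ratio G e < \<bar>L0\<bar> + 1"
    using lim by (rule order_tendstoD) simp
  then obtain e1 where e1: "e1 > 0" "\<And>e. 0 < e \<Longrightarrow> e < e1 \<Longrightarrow> tube_ratio G e < \<bar>L0\<bar> + 1"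
    unfolding eventually_at_right_field by auto
  define e0 where "e0 = min (e1 / 2) (\<rho> / 4)"
  define D :: real where "D = (2 ^ DIM('a) - 1) * 2 / \<rho>"
  have D_eq: "D * e = (2 ^ DIM('a) - 1) * (2 * e / \<rho>)" for e by (simp add: D_def)
  have D: "D \<ge> 0" using \<rho> by (auto simp: D_def)
  have step: "\<bar>tube_ratio G (2 * e) - tube_ratio G e\<bar> \<le> (D * (\<bar>L0\<bar> + 1) + 1) * e" if e: "0 < e" "e \<le> e0" for e
  proof -
    have "e < e1" "e \<le> \<rho> / 4" using e e1(1) by (auto simp: e0_def)
    have F: "tube_volume G e = 2 * e * tube_ratio G e" using e by (simp add: tube_ratio_def)
    have F0: "tube_volume G e \<ge> 0" by (simp add: tube_volume_def)
    have "2 * e / \<rho> \<le> 1" using \<open>e \<le> \<rho> / 4\<close> \<rho> by (simp add: field_simps)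
    then have "(1 + 2 * e / \<rho>) ^ DIM('a) - 1 \<le> D * e"
      using one_plus_power_le[of "2 * e / \<rho>" "DIM('a)"] e \<rho>
      by (simp add: D_eq)
    then have "2 * ((1 + 2 * e / \<rho>) ^ DIM('a) - 1) * tube_volume G e \<le> 2 * (D * e) * tube_volume G e"
      using F0 by (intro mult_right_mono mult_left_mono) auto
    with tube_volume_doubling[OF \<rho> N G null, of e] e \<open>e \<le> \<rho> / 4\<close>
    have "\<bar>tube_volume G (2 * e) - 2 * tube_volume G e\<bar> \<le> 2 * (D * e) * tube_volume G e" by linarith
    then have "\<bar>tube_volume G (2 * e) - 2 * tube_volume G e\<bar> \<le> 2 * (D * e) * (2 * e * tube_ratio G e)"
      by (simp only: F)
    moreover have "tube_ratio G (2 * e) - tube_ratio G e = (tube_volume G (2 * e) - 2 * tube_volume G e) / (4 * e)"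
      using e by (simp add: tube_ratio_def field_simps)
    ultimately have "\<bar>tube_ratio G (2 * e) - tube_ratio G e\<bar> \<le> 2 * (D * e) * (2 * e * tube_ratio G e) / (4 * e)"
      using e by (simp add: abs_divide) (simp add: field_simps)
    also have "\<dots> = D * e * tube_ratio G e" using e by (simp add: field_simps)
    also have "\<dots> \<le> D * e * (\<bar>L0\<bar> + 1)"
      using e1(2)[OF e(1) \<open>e < e1\<close>] D e by (intro mult_left_mono) auto
    also have "\<dots> \<le> (D * (\<bar>L0\<bar> + 1) + 1) * e" using e by (simp add: algebra_simps)
    finally show ?thesis .
  qed
  have "e0 > 0" using e1 \<rho> by (simp add: e0_def)
  moreover have "D * (\<bar>L0\<bar> + 1) + 1 > 0" using D by (simp add: add_nonneg_pos)
  ultimately show ?thesis using limit_rate_if_doubling[OF lim step] by blast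
qed

text \<open>
  At a boundary point \<open>t\<close> both \<open>G\<close> and the closure of \<open>R\<close> are touched from outside. The ball outside
  the closure of \<open>R\<close> lies in \<open>G\<close>, so the two balls are disjoint, which forces opposite directions. The
  assumption \<open>thick\<close> makes \<open>t\<close> a boundary point of the closure of \<open>R\<close>; it excludes pieces of \<open>G\<close> without
  interior. The open set \<open>Q\<close> keeps the outer boundary of \<open>R\<close> away.
\<close>

lemma two_sided_normal_exists:
  fixes G R Q :: "'a::euclidean_space set"
  assumes G: "compact G" "open Q" "G \<subseteq> Q" and R: "Q - G \<subseteq> R" "R \<inter> G = {}"
    and projG: "unique_proj_below r1 G" "r1 > 0"
    and projR: "unique_proj_below r2 (closure R)" "r2 > 0"
    and thick: "frontier G \<subseteq> closure (interior G)"
  shows "\<exists>\<rho>>0. \<exists>\<nu>. two_sided_normal \<rho> G \<nu>"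
proof -
  have clG: "closed G" using G by (simp add: compact_imp_closed)
  have TG: "frontier G \<subseteq> G" using clG by (simp add: frontier_subset_closed)
  obtain \<eta> where \<eta>: "\<eta> > 0" "(\<Union>x\<in>G. ball x \<eta>) \<subseteq> Q"
    using compact_subset_open_imp_ball_epsilon_subset[OF G] by blast
  define \<rho> where "\<rho> = min (\<eta> / 2) (min (r1 / 2) (r2 / 2))"
  have \<rho>: "0 < \<rho>" "\<rho> < r1" "\<rho> < r2" "2 * \<rho> \<le> \<eta>"
    using \<eta> projG projR by (auto simp: \<rho>_def)
  have "\<exists>v. norm v = 1 \<and> ball (t + \<rho> *\<^sub>R v) \<rho> \<inter> G = {} \<and> ball (t - \<rho> *\<^sub>R v) \<rho> \<subseteq> G"
    if t: "t \<in> frontier G" for t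
  proof -
    have tQ: "t \<in> Q" using t TG G by blast
    have "t \<in> closure (- G)" using t by (simp add: frontier_closures)
    then have "t \<in> closure (Q \<inter> - G)"
      using open_Int_closure_subset[OF G(2), of "- G"] tQ by blast
    then have "t \<in> closure R" using R(1) closure_mono[of "Q \<inter> - G" R] by blast
    moreover have "t \<notin> interior (closure R)"
    proof
      assume "t \<in> interior (closure R)"
      moreover have "t \<in> closure (interior G)" using t thick by blast
      ultimately have "interior (closure R) \<inter> interior G \<noteq> {}"
        using open_Int_closure_eq_empty[of "interior (closure R)" "interior G"] by blast
      then have "interior G \<inter> closure R \<noteq> {}" using interior_subset by blast
      then have "interior G \<inter> R \<noteq> {}"
        using open_Int_closure_eq_empty[of "interior G" R] by blast
      then show False using R(2) interior_subset by blast
    qed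
    ultimately have tR: "t \<in> frontier (closure R)" by (simp add: frontier_def)
    obtain v where v: "norm v = 1" "ball (t + \<rho> *\<^sub>R v) \<rho> \<inter> G = {}"
      using touching_ball_if_unique_proj[OF clG projG(1) t \<rho>(1,2)] by blast
    obtain u where u: "norm u = 1" "ball (t + \<rho> *\<^sub>R u) \<rho> \<inter> closure R = {}"
      using touching_ball_if_unique_proj[OF closed_closure projR(1) tR \<rho>(1,3)] by blast
    have "ball (t + \<rho> *\<^sub>R u) \<rho> \<subseteq> ball t (2 * \<rho>)"
    proof
      fix x assume "x \<in> ball (t + \<rho> *\<^sub>R u) \<rho>"
      then show "x \<in> ball t (2 * \<rho>)"
        using dist_triangle[of t x "t + \<rho> *\<^sub>R u"] \<rho>(1) u(1) by (simp add: dist_norm)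
    qed
    also have "\<dots> \<subseteq> Q" using \<eta> \<rho> t TG subset_ball[of "2 * \<rho>" \<eta> t] by blast
    finally have inG: "ball (t + \<rho> *\<^sub>R u) \<rho> \<subseteq> G"
      using u(2) R(1) closure_subset[of R] by blast
    then have "\<rho> + \<rho> \<le> dist (t + \<rho> *\<^sub>R v) (t + \<rho> *\<^sub>R u)"
      using v(2) \<rho>(1) by (intro add_le_dist_if_balls_disjoint) auto
    also have "\<dots> = \<rho> * norm (v - u)"
      using \<rho>(1) by (simp add: dist_norm flip: scaleR_diff_right)
    finally have "\<rho> * 2 \<le> \<rho> * norm (v - u)" by simp
    then have "2 \<le> norm (v - u)" using \<rho>(1) by simp
    then have "2\<^sup>2 \<le> (norm (v - u))\<^sup>2" by (intro power_mono) auto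
    moreover have "v \<bullet> v = 1" "u \<bullet> u = 1" using u v by (auto simp: norm_eq_1)
    ultimately have "(v + u) \<bullet> (v + u) \<le> 0"
      unfolding power2_norm_eq_inner
      by (simp add: inner_add_left inner_add_right inner_diff_left inner_diff_right inner_commute)
    then have "v + u = 0" by (metis inner_eq_zero_iff inner_ge_zero order_antisym)
    then have "u = - v" by (simp add: eq_neg_iff_add_eq_0 add.commute)
    then show ?thesis using v inG by auto
  qed
  then have "\<exists>\<nu>. two_sided_normal \<rho> G \<nu>" unfolding two_sided_normal_def by metis
  then show ?thesis using \<rho>(1) by blast
qed

text \<open>
  Near a boundary point away from the interior, \<open>G\<close> would be contained in its null boundary,
  against the positive mass of \<open>G\<close> around each boundary point.
\<close>

lemma frontier_subset_closure_interior:
  fixes G :: "'a::euclidean_space set"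
  assumes G: "closed G" and null: "measure lborel (frontier G) = 0" "compact (frontier G)"
    and dens: "\<And>t e. t \<in> frontier G \<Longrightarrow> 0 < e \<Longrightarrow> e \<le> e0 \<Longrightarrow> measure lborel (G \<inter> cball t e) > 0"
    and e0: "e0 > 0"
  shows "frontier G \<subseteq> closure (interior G)"
proof (rule ccontr)
  assume "\<not> frontier G \<subseteq> closure (interior G)"
  then obtain t where t: "t \<in> frontier G" "t \<notin> closure (interior G)" by blast
  then obtain e where e: "e > 0" "cball t e \<subseteq> - closure (interior G)"
    using open_contains_cball[of "- closure (interior G)"] by auto
  define e' where "e' = min e e0"
  have e': "e' > 0" "e' \<le> e0" "e' \<le> e" using e e0 by (auto simp: e'_def)
  have "G \<inter> cball t e' \<subseteq> frontier G"
  proof -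
    have "cball t e' \<inter> interior G = {}"
      using e(2) subset_cball[OF e'(3)] closure_subset[of "interior G"] by blast
    then show ?thesis using G by (auto simp: frontier_def)
  qed
  then have "measure lborel (G \<inter> cball t e') \<le> measure lborel (frontier G)"
    using G null(2) emeasure_compact_finite[OF null(2)]
    by (intro measure_mono_fmeasurable fmeasurableI) (auto intro!: borel_closed)
  then show False using dens[OF t(1) e'(1,2)] null(1) by simp
qed

section \<open>Tubes around the boundary and the exponential term\<close>

lemma ball_nbhd_eq_infdist_le:
  fixes T :: "'a::heine_borel set"
  assumes "closed T" "T \<noteq> {}"
  shows "ball_nbhd T e = {z. infdist z T \<le> e}"
proof (intro set_eqI iffI)
  fix z assume "z \<in> ball_nbhd T e"
  then show "z \<in> {z. infdist z T \<le> e}"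
    using infdist_le2 by (fastforce simp: ball_nbhd_def dist_commute)
next
  fix z assume "z \<in> {z. infdist z T \<le> e}"
  moreover obtain x where "x \<in> T" "infdist z T = dist z x"
    using infdist_attains_inf[OF assms] .
  ultimately show "z \<in> ball_nbhd T e" by (auto simp: ball_nbhd_def dist_commute)
qed

lemma closed_ball_nbhd:
  fixes T :: "'a::heine_borel set"
  assumes "closed T"
  shows "closed (ball_nbhd T e)"
proof (cases "T = {}")
  case False
  then show ?thesis unfolding ball_nbhd_eq_infdist_le[OF assms False]
    by (intro closed_Collect_le continuous_intros)
qed (simp add: ball_nbhd_def)

lemma bounded_ball_nbhd:
  fixes T :: "'a::euclidean_space set"
  assumes "bounded T"
  shows "bounded (ball_nbhd T e)"
proof -
  obtain B where B: "\<And>x. x \<in> T \<Longrightarrow> norm x \<le> B" using assms unfolding bounded_iff by auto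
  have "norm z \<le> B + e" if z: "z \<in> ball_nbhd T e" for z
  proof -
    obtain x where x: "x \<in> T" "dist x z \<le> e" using z by (auto simp: ball_nbhd_def)
    have "norm z \<le> norm x + dist x z"
      by (metis dist_norm norm_minus_commute norm_triangle_sub)
    then show ?thesis using x B by fastforce
  qed
  then show ?thesis unfolding bounded_iff by blast
qed

lemma compact_ball_nbhd:
  fixes T :: "'a::euclidean_space set"
  assumes "compact T"
  shows "compact (ball_nbhd T e)"
  using assms by (simp add: compact_eq_bounded_closed bounded_ball_nbhd closed_ball_nbhd)

lemma ball_nbhd_fmeasurable:
  fixes T :: "'a::euclidean_space set"
  assumes "compact T"
  shows "ball_nbhd T e \<in> fmeasurable lborel"
  using compact_ball_nbhd[OF assms] emeasure_compact_finite[OF compact_ball_nbhd[OF assms]]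
  by (intro fmeasurableI) (auto intro: borel_compact)

lemma ball_nbhd_mono: "d \<le> e \<Longrightarrow> ball_nbhd T d \<subseteq> ball_nbhd T e"
  by (force simp: ball_nbhd_def)

lemma ball_nbhd_neg: "e < 0 \<Longrightarrow> ball_nbhd T e = {}"
  by (simp add: ball_nbhd_def)

lemma ball_nbhd_0: "ball_nbhd T 0 = T"
  by (simp add: ball_nbhd_def)

lemma tube_volume_neg: "e < 0 \<Longrightarrow> tube_volume G e = 0"
  by (simp add: tube_volume_def ball_nbhd_neg)

lemma tube_volume_nonneg: "tube_volume G e \<ge> 0"
  by (simp add: tube_volume_def)

lemma tube_volume_mono:
  "compact (frontier G) \<Longrightarrow> d \<le> e \<Longrightarrow> tube_volume G d \<le> tube_volume G e"
  unfolding tube_volume_def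
  by (intro measure_mono_fmeasurable ball_nbhd_mono fmeasurableD ball_nbhd_fmeasurable)

lemma measure_tube_diff:
  "compact (frontier G) \<Longrightarrow> d \<le> e \<Longrightarrow>
   measure lborel (ball_nbhd (frontier G) e - ball_nbhd (frontier G) d) = tube_volume G e - tube_volume G d"
  unfolding tube_volume_def
  by (rule measure_Diff[OF _ fmeasurableD fmeasurableD ball_nbhd_mono])
     (use fmeasurableD2[OF ball_nbhd_fmeasurable] in \<open>auto intro: ball_nbhd_fmeasurable\<close>)

lemma tube_volume_tendsto_0:
  assumes "(tube_ratio G \<longlongrightarrow> L0) (at_right 0)"
  shows "(tube_volume G \<longlongrightarrow> 0) (at_right 0)"
proof -
  have "((\<lambda>e. 2 * e * tube_ratio G e) \<longlongrightarrow> 2 * 0 * L0) (at_right 0)"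
    by (intro tendsto_intros assms)
  moreover have "\<forall>\<^sub>F e in at_right 0. 2 * e * tube_ratio G e = tube_volume G e"
    unfolding eventually_at_right_field by (intro exI[of _ 1]) (auto simp: tube_ratio_def)
  ultimately have "(tube_volume G \<longlongrightarrow> 2 * 0 * L0) (at_right 0)" by (rule Lim_transform_eventually)
  then show ?thesis by simp
qed

text \<open>
  A finite Minkowski content forces the tube volume to vanish in the limit, and every tube contains
  the boundary.
\<close>

lemma measure_frontier_eq_0:
  assumes "(tube_ratio G \<longlongrightarrow> L0) (at_right 0)" "compact (frontier G)"
  shows "measure lborel (frontier G) = 0" "tube_volume G 0 = 0"
proof -
  have "tube_volume G 0 \<le> 0"
  proof (rule tendsto_lowerbound[OF tube_volume_tendsto_0[OF assms(1)]])
    show "\<forall>\<^sub>F e in at_right 0. tube_volume G 0 \<le> tube_volume G e"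
      unfolding eventually_at_right_field
      by (intro exI[of _ 1]) (auto intro!: tube_volume_mono assms(2))
  qed simp
  then show "tube_volume G 0 = 0" using tube_volume_nonneg[of G 0] by simp
  then show "measure lborel (frontier G) = 0" by (simp add: tube_volume_def ball_nbhd_0)
qed

lemma exp_term_nonneg: "\<epsilon> > 0 \<Longrightarrow> exp_term G K n \<epsilon> \<ge> 0"
  unfolding exp_term_def set_lebesgue_integral_def
  by (intro mult_nonneg_nonneg Bochner_Integration.integral_nonneg) auto

lemma exp_term_le:
  assumes "\<epsilon> > 0" "integrable lborel h" "\<And>z. h z \<ge> 0"
    and "\<And>z. z \<in> ball_nbhd (frontier G) \<epsilon> \<Longrightarrow>
          exp (- K * real n * (\<epsilon> - infdist z (frontier G)) ^ CARD('d)) \<le> h z"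
  shows "exp_term (G :: (real ^ 'd) set) K n \<epsilon> \<le> (\<integral>z. h z \<partial>lborel) / \<epsilon>"
proof -
  have "(LINT z : ball_nbhd (frontier G) \<epsilon> | lborel.
                exp (- K * real n * (\<epsilon> - infdist z (frontier G)) ^ CARD('d))) \<le> (\<integral>z. h z \<partial>lborel)"
    unfolding set_lebesgue_integral_def
    using assms by (intro integral_mono') (auto simp: indicator_def)
  then show ?thesis using assms(1) by (simp add: exp_term_def divide_right_mono)
qed

text \<open>
  Inside the tube of radius \<open>(1 - \<eta>) * \<epsilon>\<close> the integrand is small; in the remaining outer layer it is
  at most 1.
\<close>

lemma exp_term_split_le:
  fixes G :: "(real ^ 'd) set"
  assumes T: "compact (frontier G)" "frontier G \<noteq> {}" and \<epsilon>: "\<epsilon> > 0" and K: "K \<ge> 0"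
    and \<eta>: "0 \<le> \<eta>"
  shows "exp_term G K n \<epsilon> \<le> (exp (- K * real n * (\<eta> * \<epsilon>) ^ CARD('d)) * tube_volume G \<epsilon>
           + (tube_volume G \<epsilon> - tube_volume G ((1 - \<eta>) * \<epsilon>))) / \<epsilon>"
proof -
  define B where "B = ball_nbhd (frontier G)"
  define c where "c = exp (- K * real n * (\<eta> * \<epsilon>) ^ CARD('d))"
  have le: "(1 - \<eta>) * \<epsilon> \<le> \<epsilon>" using \<epsilon> \<eta> by (simp add: algebra_simps)
  have B: "z \<in> B e \<longleftrightarrow> infdist z (frontier G) \<le> e" for z e
    using ball_nbhd_eq_infdist_le[of "frontier G"] T by (simp add: B_def)
  define h where "h = (\<lambda>z. c * indicat_real (B \<epsilon>) z + indicat_real (B \<epsilon> - B ((1 - \<eta>) * \<epsilon>)) z)"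
  have fm: "B e \<in> fmeasurable lborel" for e unfolding B_def by (rule ball_nbhd_fmeasurable[OF T(1)])
  then have fmd: "B \<epsilon> - B ((1 - \<eta>) * \<epsilon>) \<in> fmeasurable lborel" by (rule fmeasurable_Diff) (use fm in blast)
  have int: "integrable lborel (indicat_real S)" if "S \<in> fmeasurable lborel" for S :: "(real ^ 'd) set"
    using that by (intro integrable_real_indicator) (auto simp: fmeasurable_def)
  have inth: "integrable lborel h"
    unfolding h_def by (intro Bochner_Integration.integrable_add integrable_mult_right int fm fmd)
  have "exp_term G K n \<epsilon> \<le> (\<integral>z. h z \<partial>lborel) / \<epsilon>"
  proof (rule exp_term_le[OF \<epsilon> inth])
    show "h z \<ge> 0" for z by (simp add: h_def c_def indicator_def)
    fix z assume "z \<in> ball_nbhd (frontier G) \<epsilon>"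
    then have z: "z \<in> B \<epsilon>" by (simp add: B_def)
    define g where "g = exp (- K * real n * (\<epsilon> - infdist z (frontier G)) ^ CARD('d))"
    have "0 \<le> \<epsilon> - infdist z (frontier G)" using z B by simp
    then have g1: "g \<le> 1" using K by (simp add: g_def)
    show "g \<le> h z"
    proof (cases "z \<in> B ((1 - \<eta>) * \<epsilon>)")
      case True
      then have "\<eta> * \<epsilon> \<le> \<epsilon> - infdist z (frontier G)" using B by (simp add: algebra_simps)
      then have "(\<eta> * \<epsilon>) ^ CARD('d) \<le> (\<epsilon> - infdist z (frontier G)) ^ CARD('d)"
        using \<eta> \<epsilon> by (intro power_mono) auto
      then have "K * real n * (\<eta> * \<epsilon>) ^ CARD('d) \<le> K * real n * (\<epsilon> - infdist z (frontier G)) ^ CARD('d)"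
        using K by (intro mult_left_mono) auto
      then have "g \<le> c" by (simp add: g_def c_def)
      then show ?thesis using z True by (simp add: h_def)
    next
      case False
      then show ?thesis using z g1 by (simp add: h_def add_increasing c_def)
    qed
  qed
  also have "(\<integral>z. h z \<partial>lborel) = c * tube_volume G \<epsilon> + (tube_volume G \<epsilon> - tube_volume G ((1 - \<eta>) * \<epsilon>))"
    using measure_tube_diff[OF T(1) le]
    unfolding h_def
    by (subst Bochner_Integration.integral_add)
       (use fm fmd in \<open>auto intro!: int simp: B_def tube_volume_def\<close>)
  finally show ?thesis by (simp add: c_def)
qed

text \<open>
  In the preceding bound the first summand tends to 0 for fixed \<open>\<eta>\<close>, and the second one tends
  to \<open>2 * L0 * \<eta>\<close>, which is as small as desired.
\<close>

lemma exp_term_tendsto_0: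
  fixes G :: "(real ^ 'd) set" and \<epsilon> :: "nat \<Rightarrow> real"
  assumes T: "compact (frontier G)" "frontier G \<noteq> {}"
    and lim: "(tube_ratio G \<longlongrightarrow> L0) (at_right 0)" "L0 > 0" and K: "K > 0"
    and eps: "\<forall>\<^sub>F n in sequentially. \<epsilon> n > 0" "\<epsilon> \<longlonglongrightarrow> 0"
      "filterlim (\<lambda>n. real n * \<epsilon> n ^ CARD('d)) at_top sequentially"
  shows "(\<lambda>n. exp_term G K n (\<epsilon> n)) \<longlonglongrightarrow> 0"
proof (rule order_tendstoI)
  fix y :: real assume "y < 0"
  show "\<forall>\<^sub>F n in sequentially. y < exp_term G K n (\<epsilon> n)"
    using eps(1) by eventually_elim (use \<open>y < 0\<close> exp_term_nonneg less_le_trans in blast)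
next
  fix y :: real assume y: "0 < y"
  define \<eta> where "\<eta> = min (1 / 2) (y / (4 * L0))"
  have \<eta>: "0 < \<eta>" "\<eta> < 1" using y lim(2) by (auto simp: \<eta>_def)
  have "2 * L0 * \<eta> \<le> 2 * L0 * (y / (4 * L0))"
    using lim(2) by (intro mult_left_mono) (auto simp: \<eta>_def)
  then have \<eta>y: "2 * L0 * \<eta> < y" using lim(2) y by simp
  have fl: "filterlim (\<lambda>n. c * \<epsilon> n) (at_right 0) sequentially" if "c > 0" for c
  proof (rule tendsto_imp_filterlim_at_right)
    show "(\<lambda>n. c * \<epsilon> n) \<longlonglongrightarrow> 0" using tendsto_mult_left[OF eps(2), of c] by simp
    show "\<forall>\<^sub>F n in sequentially. 0 < c * \<epsilon> n" using eps(1) by eventually_elim (use that in auto)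
  qed
  have r: "(\<lambda>n. tube_ratio G (c * \<epsilon> n)) \<longlonglongrightarrow> L0" if "c > 0" for c
    by (rule filterlim_compose[OF lim(1) fl[OF that]])
  have "filterlim (\<lambda>n. (K * \<eta> ^ CARD('d)) * (real n * \<epsilon> n ^ CARD('d))) at_top sequentially"
    using K \<eta> by (intro filterlim_tendsto_pos_mult_at_top[OF tendsto_const _ eps(3)]) auto
  then have "(\<lambda>n. exp (- ((K * \<eta> ^ CARD('d)) * (real n * \<epsilon> n ^ CARD('d))))) \<longlonglongrightarrow> 0"
    by (intro filterlim_compose[OF exp_at_bot]) (simp add: filterlim_uminus_at_top)
  then have ex: "(\<lambda>n. exp (- K * real n * (\<eta> * \<epsilon> n) ^ CARD('d))) \<longlonglongrightarrow> 0"
    by (simp add: power_mult_distrib mult_ac)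
  define b where "b = (\<lambda>n. exp (- K * real n * (\<eta> * \<epsilon> n) ^ CARD('d)) * (2 * tube_ratio G (1 * \<epsilon> n))
       + (2 * tube_ratio G (1 * \<epsilon> n) - (1 - \<eta>) * (2 * tube_ratio G ((1 - \<eta>) * \<epsilon> n))))"
  have "b \<longlonglongrightarrow> 0 * (2 * L0) + (2 * L0 - (1 - \<eta>) * (2 * L0))"
    unfolding b_def using \<eta> by (intro tendsto_intros ex r) auto
  then have "b \<longlonglongrightarrow> 2 * L0 * \<eta>" by (simp add: algebra_simps)
  then have "\<forall>\<^sub>F n in sequentially. b n < y" using \<eta>y by (rule order_tendstoD)
  then show "\<forall>\<^sub>F n in sequentially. exp_term G K n (\<epsilon> n) < y"
    using eps(1)
  proof eventually_elim
    case (elim n)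
    have "2 * tube_ratio G (1 * \<epsilon> n) = tube_volume G (\<epsilon> n) / \<epsilon> n"
      and "(1 - \<eta>) * (2 * tube_ratio G ((1 - \<eta>) * \<epsilon> n)) = tube_volume G ((1 - \<eta>) * \<epsilon> n) / \<epsilon> n"
      using \<eta> by (simp_all add: tube_ratio_def)
    then have "exp_term G K n (\<epsilon> n) \<le> b n"
      using exp_term_split_le[OF T elim(2), of K \<eta> n] K \<eta>
      by (simp only: b_def add_divide_distrib diff_divide_distrib times_divide_eq_right less_imp_le)
    then show ?case using elim by simp
  qed
qed

lemma tube_volume_lipschitz_near_0:
  assumes "\<exists>\<eta>>0. \<exists>F'.
          (\<forall>e\<in>{0..<\<eta>}. (tube_volume G has_real_derivative F' e) (at e within {0..})) \<and>
          continuous (at 0 within {0..}) F'"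
  shows "\<exists>B>0. \<exists>e1>0. \<forall>a b. 0 \<le> a \<longrightarrow> a \<le> b \<longrightarrow> b \<le> e1 \<longrightarrow> tube_volume G b - tube_volume G a \<le> B * (b - a)"
proof -
  obtain \<eta> F' where \<eta>: "\<eta> > 0"
    and der: "\<And>e. e \<in> {0..<\<eta>} \<Longrightarrow> (tube_volume G has_real_derivative F' e) (at e within {0..})"
    and cont: "continuous (at 0 within {0..}) F'"
    using assms by blast
  obtain d where d: "d > 0" "\<And>x. x \<in> {0..} \<Longrightarrow> dist x 0 < d \<Longrightarrow> dist (F' x) (F' 0) < 1"
    using cont unfolding continuous_within_eps_delta by (metis zero_less_one)
  define e1 where "e1 = min \<eta> d / 2"
  have e1: "e1 > 0" "e1 < \<eta>" "e1 < d" using \<eta> d(1) by (auto simp: e1_def)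
  have bd: "norm (F' x) \<le> \<bar>F' 0\<bar> + 1" if "x \<in> {0..e1}" for x
  proof -
    have "dist (F' x) (F' 0) < 1" using that e1 by (intro d(2)) auto
    then show ?thesis unfolding dist_real_def real_norm_def by linarith
  qed
  have der': "(tube_volume G has_field_derivative F' x) (at x within {0..e1})" if "x \<in> {0..e1}" for x
    by (rule DERIV_subset[OF der]) (use that e1 in auto)
  have "tube_volume G b - tube_volume G a \<le> (\<bar>F' 0\<bar> + 1) * (b - a)" if "0 \<le> a" "a \<le> b" "b \<le> e1" for a b
  proof -
    have "norm (tube_volume G b - tube_volume G a) \<le> (\<bar>F' 0\<bar> + 1) * norm (b - a)"
      by (rule field_differentiable_bound[OF _ der' bd]) (use that in auto)
    then show ?thesis using that by simp
  qed
  then show ?thesis using e1(1) by (intro exI[of _ "\<bar>F' 0\<bar> + 1"] conjI exI[of _ e1]) auto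
qed

text \<open>
  A point of the layer \<open>S j\<close> is at least \<open>j * h\<close> away from the outer rim of the tube, and
  \<open>n * h ^ d = 1\<close>, so the integrand is at most \<open>exp (- K * j)\<close> there. Since each layer has volume at
  most \<open>B * h\<close>, a geometric series remains.
\<close>

lemma exp_term_rate:
  fixes G :: "(real ^ 'd) set"
  assumes T: "compact (frontier G)" "frontier G \<noteq> {}" and F0: "tube_volume G 0 = 0"
    and lip: "\<And>a b. 0 \<le> a \<Longrightarrow> a \<le> b \<Longrightarrow> b \<le> e1 \<Longrightarrow> tube_volume G b - tube_volume G a \<le> B * (b - a)"
    and B: "B > 0" and \<epsilon>: "0 < \<epsilon>" "\<epsilon> \<le> e1" and K: "K > 0" and n: "n \<ge> 1"
  shows "exp_term G K n \<epsilon> \<le> B / (1 - exp (- K)) * (real n * \<epsilon> ^ CARD('d)) powr (- 1 / real CARD('d))"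
proof -
  let ?d = "CARD('d)"
  define h where "h = real n powr (- 1 / real ?d)"
  have h: "h > 0" using n by (simp add: h_def)
  have "h ^ ?d = real n powr (- 1)"
    using n by (simp add: h_def powr_realpow[symmetric] powr_powr)
  then have hd: "real n * h ^ ?d = 1" using n by (simp add: powr_minus_divide)
  \<comment> \<open>The innermost layer \<open>S N\<close> may reach beyond distance 0; tubes of negative radius are empty.\<close>
  define N where "N = nat \<lfloor>\<epsilon> / h\<rfloor>"
  define W where "W = (\<lambda>e. ball_nbhd (frontier G) e)"
  have W: "z \<in> W e \<longleftrightarrow> infdist z (frontier G) \<le> e" for z e
    using ball_nbhd_eq_infdist_le[of "frontier G"] T by (simp add: W_def)
  define S where "S = (\<lambda>j::nat. W (\<epsilon> - real j * h) - W (\<epsilon> - real (Suc j) * h))"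
  have fm: "W e \<in> fmeasurable lborel" for e unfolding W_def by (rule ball_nbhd_fmeasurable[OF T(1)])
  have fmS: "S j \<in> fmeasurable lborel" for j
    unfolding S_def by (rule fmeasurable_Diff[OF fm]) (use fm in blast)
  have mS: "measure lborel (S j) \<le> B * h" if "j \<le> N" for j
  proof -
    define b where "b = \<epsilon> - real j * h"
    have "real j \<le> \<epsilon> / h" using that \<epsilon> h unfolding N_def by (simp add: le_nat_floor le_nat_iff le_floor_iff)
    then have "real j * h \<le> \<epsilon>" using h by (simp add: field_simps)
    moreover have "0 \<le> real j * h" using h by simp
    ultimately have b: "0 \<le> b" "b \<le> e1" using \<epsilon> by (auto simp: b_def)
    have "measure lborel (S j) = tube_volume G b - tube_volume G (b - h)"
      using measure_tube_diff[OF T(1), of "b - h" b] h by (simp add: S_def W_def b_def algebra_simps)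
    also have "\<dots> \<le> B * h"
    proof (cases "b - h \<ge> 0")
      case True
      then show ?thesis using lip[of "b - h" b] b h by simp
    next
      case False
      then have "tube_volume G b - tube_volume G (b - h) = tube_volume G b - tube_volume G 0"
        using F0 by (simp add: tube_volume_neg)
      also have "\<dots> \<le> B * (b - 0)" using b by (intro lip) auto
      also have "\<dots> \<le> B * h" using False B by (intro mult_left_mono) auto
      finally show ?thesis .
    qed
    finally show ?thesis .
  qed
  define f where "f = (\<lambda>z. \<Sum>j\<le>N. exp (- K * real j) * indicat_real (S j) z)"
  have intf: "integrable lborel f"
    unfolding f_def using fmS
    by (intro Bochner_Integration.integrable_sum integrable_mult_right integrable_real_indicator)
       (auto simp: fmeasurable_def)
  have "exp_term G K n \<epsilon> \<le> (\<integral>z. f z \<partial>lborel) / \<epsilon>"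
  proof (rule exp_term_le[OF \<epsilon>(1) intf])
    show "f z \<ge> 0" for z by (simp add: f_def sum_nonneg)
    fix z assume "z \<in> ball_nbhd (frontier G) \<epsilon>"
    then have z: "infdist z (frontier G) \<le> \<epsilon>" using W[of z \<epsilon>] by (simp add: W_def)
    define u where "u = \<epsilon> - infdist z (frontier G)"
    have u: "0 \<le> u" "u \<le> \<epsilon>" using z infdist_nonneg by (auto simp: u_def)
    define j where "j = nat \<lfloor>u / h\<rfloor>"
    have jN: "j \<le> N" using u h unfolding j_def N_def by (intro nat_mono floor_mono divide_right_mono) auto
    have "real j \<le> u / h" "u / h < real j + 1"
      using u h by (auto simp: j_def)
    then have j: "real j * h \<le> u" "u < real (Suc j) * h" using h by (auto simp: field_simps)
    then have zS: "z \<in> S j" by (auto simp: S_def W u_def)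
    have "real j \<le> real j ^ ?d"
    proof (cases "j = 0")
      case False
      then show ?thesis by (intro self_le_power) auto
    qed simp
    also have "\<dots> = real n * (real j * h) ^ ?d"
      using hd by (simp add: power_mult_distrib mult.left_commute)
    also have "\<dots> \<le> real n * u ^ ?d"
      using j h by (intro mult_left_mono power_mono) auto
    finally have "K * real j \<le> K * (real n * u ^ ?d)" using K by simp
    then have "exp (- K * real n * u ^ ?d) \<le> exp (- K * real j)" by simp
    also have "\<dots> = exp (- K * real j) * indicat_real (S j) z" using zS by simp
    also have "\<dots> \<le> f z"
      unfolding f_def using jN by (intro member_le_sum) auto
    finally show "exp (- K * real n * (\<epsilon> - infdist z (frontier G)) ^ ?d) \<le> f z" by (simp add: u_def)
  qed
  also have "(\<integral>z. f z \<partial>lborel) = (\<Sum>j\<le>N. exp (- K * real j) * measure lborel (S j))"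
    unfolding f_def using fmS
    by (subst Bochner_Integration.integral_sum) (auto simp: fmeasurable_def)
  also have "\<dots> \<le> (\<Sum>j\<le>N. exp (- K * real j) * (B * h))"
    using mS by (intro sum_mono mult_left_mono) auto
  also have "\<dots> = B * h * (\<Sum>j\<le>N. exp (- K) ^ j)"
    by (simp add: sum_distrib_left mult_ac exp_of_nat_mult[symmetric])
  also have "(\<Sum>j\<le>N. exp (- K) ^ j) \<le> 1 / (1 - exp (- K))"
  proof -
    have "(\<Sum>j\<le>N. exp (- K) ^ j) \<le> (\<Sum>j. exp (- K) ^ j)"
      using K by (intro sum_le_suminf summable_geometric) auto
    then show ?thesis using K by (simp add: suminf_geometric)
  qed
  finally have "exp_term G K n \<epsilon> \<le> B * h * (1 / (1 - exp (- K))) / \<epsilon>"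
    using \<epsilon> B h by (simp add: divide_right_mono mult_left_mono)
  also have "\<dots> = B / (1 - exp (- K)) * (h / \<epsilon>)" by simp
  also have "h / \<epsilon> = (real n * \<epsilon> ^ ?d) powr (- 1 / real ?d)"
    using n \<epsilon> by (simp add: h_def powr_mult powr_realpow[symmetric] powr_powr powr_minus_divide)
  finally show ?thesis .
qed

section \<open>The sample and the expected error\<close>

lemma mem_boundary_est_iff:
  "z \<in> boundary_est x b n e \<longleftrightarrow>
     z \<in> cbox 0 1 \<and> (\<forall>k\<in>{0, 1}. \<exists>i\<in>{1..n}. b i = k \<and> norm (x i - z) \<le> e)"
proof -
  have "1 \<le> label_count k x b n z e \<longleftrightarrow> (\<exists>i\<in>{1..n}. b i = k \<and> norm (x i - z) \<le> e)" for k
    by (auto simp: label_count_def Suc_le_eq card_gt_0_iff)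
  then show ?thesis by (auto simp: boundary_est_def)
qed

text \<open>
  Among the two sample points that make \<open>z\<close> an element, one lies on the other side of the boundary
  than \<open>z\<close>. The segment to it crosses the boundary.
\<close>

lemma boundary_est_subset_tube:
  assumes labels: "\<And>i. i \<in> {1..n} \<Longrightarrow> b i = (if x i \<in> G then 1 else 0)"
  shows "boundary_est x b n e \<subseteq> ball_nbhd (frontier G) e"
proof
  fix z assume z: "z \<in> boundary_est x b n e"
  obtain i where i: "i \<in> {1..n}" "b i = 1" "norm (x i - z) \<le> e"
    using z unfolding mem_boundary_est_iff by blast
  obtain j where j: "j \<in> {1..n}" "b j = 0" "norm (x j - z) \<le> e"
    using z unfolding mem_boundary_est_iff by blast
  have ij: "x i \<in> G" "x j \<notin> G"
    using labels[OF i(1)] labels[OF j(1)] i(2) j(2) by (metis zero_neq_one)+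
  obtain y where y: "norm (y - z) \<le> e" "y \<in> G \<longleftrightarrow> z \<notin> G"
  proof (cases "z \<in> G")
    case True
    then show ?thesis using j(3) ij by (intro that[of "x j"]) auto
  next
    case False
    then show ?thesis using i(3) ij by (intro that[of "x i"]) auto
  qed
  have "closed_segment z y \<inter> frontier G \<noteq> {}"
  proof (rule connected_Int_frontier)
    show "closed_segment z y \<inter> G \<noteq> {}" "closed_segment z y - G \<noteq> {}"
      using y(2) ends_in_segment[of z y] by blast+
  qed simp
  then obtain w where w: "w \<in> closed_segment z y" "w \<in> frontier G" by blast
  have "dist w z \<le> dist z y" using segment_bound(1)[OF w(1)] by (simp add: dist_norm norm_minus_commute)
  then have "dist w z \<le> e" using y by (simp add: dist_norm norm_minus_commute)
  then show "z \<in> ball_nbhd (frontier G) e" using w by (auto simp: ball_nbhd_def)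
qed

lemma measure_unit_cube: "measure lborel (cbox 0 (1 :: real ^ 'd)) = 1"
  by (subst content_cbox_cart) (auto simp: interval_ne_empty_cart)

locale labelled_sample =
  fixes G :: "(real ^ 'd) set" and M :: "'w measure"
    and Z :: "nat \<Rightarrow> 'w \<Rightarrow> real ^ 'd" and \<delta> :: "nat \<Rightarrow> 'w \<Rightarrow> nat"
  assumes borel_G [measurable]: "G \<in> sets borel"
    and iid: "iid_copies M (borel \<Otimes>\<^sub>M count_space UNIV) (\<lambda>i \<omega>. (Z i \<omega>, \<delta> i \<omega>)) (sample_law G)"
begin

sublocale prob_space M
  using iid by (simp add: iid_copies_def)

abbreviation sample_space :: "((real ^ 'd) \<times> nat) measure" where
  "sample_space \<equiv> borel \<Otimes>\<^sub>M count_space UNIV"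

lemma indep: "indep_vars (\<lambda>_. sample_space) (\<lambda>i \<omega>. (Z i \<omega>, \<delta> i \<omega>)) {1..}"
  using iid by (simp add: iid_copies_def)

lemma measurable_sample: "i \<ge> 1 \<Longrightarrow> (\<lambda>\<omega>. (Z i \<omega>, \<delta> i \<omega>)) \<in> M \<rightarrow>\<^sub>M sample_space"
  using indep unfolding indep_vars_def by auto

lemma measurable_Z: "i \<ge> 1 \<Longrightarrow> Z i \<in> borel_measurable M"
  using measurable_compose[OF measurable_sample measurable_fst] by simp

lemma measurable_\<delta>: "i \<ge> 1 \<Longrightarrow> \<delta> i \<in> M \<rightarrow>\<^sub>M count_space UNIV"
  using measurable_compose[OF measurable_sample measurable_snd] by simp

lemma prob_sample:
  assumes i: "i \<ge> 1" and A: "A \<in> sets sample_space"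
  shows "prob ((\<lambda>\<omega>. (Z i \<omega>, \<delta> i \<omega>)) -` A \<inter> space M)
       = measure lborel {z \<in> cbox 0 1. (z, if z \<in> G then 1 else 0) \<in> A}"
proof -
  let ?U = "uniform_measure lborel (cbox 0 (1 :: real ^ 'd))"
  let ?f = "\<lambda>z. (z, if z \<in> G then 1 else 0) :: (real ^ 'd) \<times> nat"
  have f: "?f \<in> ?U \<rightarrow>\<^sub>M sample_space"
    by (subst measurable_cong_sets[of ?U borel]) auto
  have "prob ((\<lambda>\<omega>. (Z i \<omega>, \<delta> i \<omega>)) -` A \<inter> space M)
      = measure (distr M sample_space (\<lambda>\<omega>. (Z i \<omega>, \<delta> i \<omega>))) A"
    using measurable_sample[OF i] A by (simp add: measure_distr)
  also have "\<dots> = measure (sample_law G) A"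
    using iid i by (simp add: iid_copies_def)
  also have "\<dots> = measure ?U (?f -` A)"
    using f A by (simp add: sample_law_def measure_distr)
  also have "\<dots> = measure lborel (cbox 0 1 \<inter> ?f -` A) / measure lborel (cbox 0 (1 :: real ^ 'd))"
  proof (rule measure_uniform_measure)
    show "emeasure lborel (cbox 0 (1 :: real ^ 'd)) \<noteq> 0"
      using measure_unit_cube[where 'd = 'd] by (metis measure_def enn2real_0 zero_neq_one)
    show "emeasure lborel (cbox 0 (1 :: real ^ 'd)) \<noteq> \<infinity>"
      using emeasure_lborel_cbox_finite[of "0 :: real ^ 'd" 1] by simp
    show "?f -` A \<in> sets lborel" using measurable_sets[OF f A] by simp
  qed
  also have "cbox 0 1 \<inter> ?f -` A = {z \<in> cbox 0 1. ?f z \<in> A}" by auto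
  finally show ?thesis by (simp add: measure_unit_cube)
qed

text \<open>
  The label is determined by the location only almost surely, since only the law of the pair
  is given.
\<close>

lemma AE_label:
  assumes i: "i \<ge> 1"
  shows "AE \<omega> in M. \<delta> i \<omega> = (if Z i \<omega> \<in> G then 1 else 0)"
proof -
  define A where "A = {p \<in> space sample_space. fst p \<in> G \<and> snd p = 1 \<or> fst p \<notin> G \<and> snd p = 0}"
  have A: "A \<in> sets sample_space" unfolding A_def by measurable
  have "{z \<in> cbox 0 1. (z, if z \<in> G then 1 else 0) \<in> A} = cbox 0 1"
    by (auto simp: A_def space_pair_measure)
  then have "prob ((\<lambda>\<omega>. (Z i \<omega>, \<delta> i \<omega>)) -` A \<inter> space M) = 1"
    using prob_sample[OF i A] measure_unit_cube by simp
  then have "AE \<omega> in M. \<omega> \<in> (\<lambda>\<omega>. (Z i \<omega>, \<delta> i \<omega>)) -` A \<inter> space M"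
    by (intro AE_prob_1)
  then show ?thesis by eventually_elim (auto simp: A_def)
qed

definition label_mass :: "nat \<Rightarrow> real ^ 'd \<Rightarrow> real \<Rightarrow> real" where
  "label_mass k z e = measure lborel {x \<in> cbox 0 1. (if x \<in> G then 1 else 0) = k \<and> norm (x - z) \<le> e}"

definition missed :: "nat \<Rightarrow> nat \<Rightarrow> real ^ 'd \<Rightarrow> real \<Rightarrow> 'w set" where
  "missed k n z e = {\<omega> \<in> space M. \<forall>i\<in>{1..n}. \<not> (\<delta> i \<omega> = k \<and> norm (Z i \<omega> - z) \<le> e)}"

lemma missed_events: "missed k n z e \<in> events"
proof -
  have [measurable]: "Z i \<in> borel_measurable M" "\<delta> i \<in> M \<rightarrow>\<^sub>M count_space UNIV" if "i \<in> {1..n}" for i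
    using that by (auto intro: measurable_Z measurable_\<delta>)
  show ?thesis unfolding missed_def by measurable
qed

text \<open>
  By independence the probability is the \<open>n\<close>th power of one minus the label mass.
\<close>

lemma prob_missed_le:
  "prob (missed k n z e) \<le> exp (- (real n * label_mass k z e))"
proof (cases "n = 0")
  case False
  let ?X = "\<lambda>i \<omega>. (Z i \<omega>, \<delta> i \<omega>)"
  define A where "A = {p \<in> space sample_space. snd p = k \<and> norm (fst p - z) \<le> e}"
  have A: "A \<in> sets sample_space" unfolding A_def by measurable
  define A' where "A' = space sample_space - A"
  have A': "A' \<in> sets sample_space" using A by (auto simp: A'_def)
  define p where "p = label_mass k z e"
  have hit: "prob (?X i -` A \<inter> space M) = p" if "i \<ge> 1" for i
  proof -
    have "{x \<in> cbox 0 1. (x, if x \<in> G then 1 else 0) \<in> A}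
        = {x \<in> cbox 0 1. (if x \<in> G then 1 else 0) = k \<and> norm (x - z) \<le> e}"
      by (auto simp: A_def space_pair_measure)
    then show ?thesis using prob_sample[OF that A] by (simp add: p_def label_mass_def)
  qed
  have miss: "prob (?X i -` A' \<inter> space M) = 1 - p" if "i \<ge> 1" for i
  proof -
    have "?X i -` A' \<inter> space M = space M - (?X i -` A \<inter> space M)"
      by (auto simp: A'_def space_pair_measure)
    then show ?thesis
      using prob_compl[OF measurable_sets[OF measurable_sample[OF that] A]] hit[OF that] by simp
  qed
  have "missed k n z e = (\<Inter>i\<in>{1..n}. ?X i -` A' \<inter> space M)"
    using False by (auto simp: missed_def A'_def A_def space_pair_measure)
  then have "prob (missed k n z e) = (\<Prod>i\<in>{1..n}. prob (?X i -` A' \<inter> space M))"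
    using indep_varsD[OF indep, of "{1..n}" "\<lambda>_. A'"] False A' by auto
  also have "\<dots> = (1 - p) ^ n" using miss by simp
  also have "\<dots> \<le> exp (- p) ^ n"
  proof (rule power_mono)
    show "1 - p \<le> exp (- p)" using exp_ge_add_one_self[of "- p"] by simp
    show "0 \<le> 1 - p" using miss[of 1] measure_nonneg[of M] by (metis le_refl)
  qed
  also have "\<dots> = exp (- (real n * p))" by (simp add: exp_of_nat_mult[symmetric])
  finally show ?thesis by (simp add: p_def)
qed simp

abbreviation est :: "nat \<Rightarrow> real \<Rightarrow> 'w \<Rightarrow> (real ^ 'd) set" where
  "est n e \<omega> \<equiv> boundary_est (\<lambda>i. Z i \<omega>) (\<lambda>i. \<delta> i \<omega>) n e"

lemma est_measurable:
  "{p \<in> space (M \<Otimes>\<^sub>M lborel). snd p \<in> est n e (fst p)} \<in> sets (M \<Otimes>\<^sub>M lborel)"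
proof -
  have [measurable]: "Z i \<in> borel_measurable M" "\<delta> i \<in> M \<rightarrow>\<^sub>M count_space UNIV" if "i \<in> {1..n}" for i
    using that by (auto intro: measurable_Z measurable_\<delta>)
  show ?thesis unfolding mem_boundary_est_iff by measurable
qed

lemma not_in_est:
  "z \<in> cbox 0 1 \<Longrightarrow> {\<omega> \<in> space M. z \<notin> est n e \<omega>} = missed 0 n z e \<union> missed 1 n z e"
  unfolding mem_boundary_est_iff missed_def by auto

lemma AE_est_subset: "AE \<omega> in M. est n e \<omega> \<subseteq> ball_nbhd (frontier G) e"
proof -
  have "AE \<omega> in M. \<forall>i\<in>{1..n}. \<delta> i \<omega> = (if Z i \<omega> \<in> G then 1 else 0)"
    by (rule AE_finite_allI) (use AE_label in auto)
  then show ?thesis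
    by eventually_elim (rule boundary_est_subset_tube, auto)
qed

text \<open>
  The error is at most the bias plus the missed volume over \<open>2 * e\<close>. By Fubini the expected missed
  volume is the integral over the tube of the probabilities bounded in the assumption; the factor 2 cancels
  against the 2 in the normalisation.
\<close>

lemma expectation_abs_error_le:
  assumes T: "compact (frontier G)" and e: "e > 0"
    and miss: "\<And>z. z \<in> ball_nbhd (frontier G) e \<Longrightarrow>
      prob {\<omega> \<in> space M. z \<notin> est n e \<omega>} \<le> 2 * exp (- K * real n * (e - infdist z (frontier G)) ^ CARD('d))"
  shows "integrable M (abs_error Z \<delta> L0 n e)"
    and "expectation (abs_error Z \<delta> L0 n e) \<le> error_bound G L0 K n e"
proof -
  define B where "B = ball_nbhd (frontier G) e"
  have B: "B \<in> fmeasurable lborel" unfolding B_def by (rule ball_nbhd_fmeasurable[OF T])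
  then have Bm [measurable]: "B \<in> sets borel" by (auto simp: fmeasurable_def)
  define D where "D = {p \<in> space (M \<Otimes>\<^sub>M lborel). snd p \<in> est n e (fst p)}"
  have D [measurable]: "D \<in> sets (M \<Otimes>\<^sub>M lborel)" unfolding D_def by (rule est_measurable)
  define D' where "D' = {p \<in> space (M \<Otimes>\<^sub>M lborel). snd p \<in> B \<and> p \<notin> D}"
  have D' [measurable]: "D' \<in> sets (M \<Otimes>\<^sub>M lborel)" unfolding D'_def by measurable
  have secD: "Pair \<omega> -` D = est n e \<omega>" "Pair \<omega> -` D' = B - est n e \<omega>" if "\<omega> \<in> space M" for \<omega>
    using that by (auto simp: D_def D'_def space_pair_measure)
  have estm: "est n e \<omega> \<in> sets borel" if "\<omega> \<in> space M" for \<omega>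
    using sets_Pair1[OF D, of \<omega>] secD(1)[OF that] by simp
  have estf: "measure lborel (est n e \<omega>) \<le> 1" if "\<omega> \<in> space M" for \<omega>
  proof -
    have "measure lborel (est n e \<omega>) \<le> measure lborel (cbox 0 (1 :: real ^ 'd))"
      using estm[OF that] by (intro measure_mono_fmeasurable) (auto simp: boundary_est_def)
    then show ?thesis by (simp add: measure_unit_cube)
  qed
  have mT: "(\<lambda>\<omega>. measure lborel (est n e \<omega>)) \<in> borel_measurable M"
    using borel_measurable_enn2real[OF lborel.measurable_emeasure_Pair[OF D]] secD(1)
    by (subst measurable_cong[of M _ "\<lambda>\<omega>. enn2real (emeasure lborel (Pair \<omega> -` D))"]) (auto simp: measure_def)
  have eV: "(\<lambda>\<omega>. emeasure lborel (Pair \<omega> -` D')) \<in> borel_measurable M"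
    by (rule lborel.measurable_emeasure_Pair[OF D'])
  define V where "V = (\<lambda>\<omega>. measure lborel (B - est n e \<omega>))"
  have mV: "V \<in> borel_measurable M"
    using borel_measurable_enn2real[OF eV] secD(2)
    by (subst measurable_cong[of M _ "\<lambda>\<omega>. enn2real (emeasure lborel (Pair \<omega> -` D'))"])
       (auto simp: V_def measure_def)
  have diff: "B - est n e \<omega> \<in> fmeasurable lborel" if "\<omega> \<in> space M" for \<omega>
    using fmeasurable_Diff[OF B] estm[OF that] by simp
  have V_le: "V \<omega> \<le> tube_volume G e" if "\<omega> \<in> space M" for \<omega>
    unfolding V_def tube_volume_def B_def[symmetric]
    using fmeasurableD[OF diff[OF that]] B by (intro measure_mono_fmeasurable) auto
  have intV: "integrable M V"
  proof (rule integrable_const_bound[where B = "tube_volume G e"])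
    show "AE \<omega> in M. norm (V \<omega>) \<le> tube_volume G e"
      using V_le by (intro AE_I2) (simp add: V_def)
  qed (rule mV)
  show int: "integrable M (abs_error Z \<delta> L0 n e)"
  proof (rule integrable_const_bound[where B = "1 / (2 * e) + \<bar>L0\<bar>"])
    show "abs_error Z \<delta> L0 n e \<in> borel_measurable M"
      unfolding abs_error_def content_est_def using mT by measurable
    show "AE \<omega> in M. norm (abs_error Z \<delta> L0 n e \<omega>) \<le> 1 / (2 * e) + \<bar>L0\<bar>"
    proof (rule AE_I2)
      fix \<omega> assume "\<omega> \<in> space M"
      then have "measure lborel (est n e \<omega>) / (2 * e) \<le> 1 / (2 * e)"
        using estf e by (intro divide_right_mono) auto
      moreover have "0 \<le> measure lborel (est n e \<omega>) / (2 * e)" using e by simp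
      ultimately show "norm (abs_error Z \<delta> L0 n e \<omega>) \<le> 1 / (2 * e) + \<bar>L0\<bar>"
        unfolding abs_error_def content_est_def real_norm_def by linarith
    qed
  qed
  have AE_le: "AE \<omega> in M. abs_error Z \<delta> L0 n e \<omega> \<le> \<bar>tube_ratio G e - L0\<bar> + V \<omega> / (2 * e)"
    using AE_est_subset[of n e] AE_space
  proof eventually_elim
    case (elim \<omega>)
    have "V \<omega> = tube_volume G e - measure lborel (est n e \<omega>)"
      unfolding V_def tube_volume_def B_def[symmetric]
      using elim B estm[OF elim(2)] by (intro measure_Diff) (auto simp: B_def[symmetric] fmeasurable_def)
    then have "V \<omega> / (2 * e) = tube_ratio G e - content_est (\<lambda>i. Z i \<omega>) (\<lambda>i. \<delta> i \<omega>) n e"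
      by (simp add: tube_ratio_def content_est_def diff_divide_distrib)
    moreover have "0 \<le> V \<omega> / (2 * e)" using e by (simp add: V_def)
    ultimately show ?case unfolding abs_error_def by linarith
  qed
  define g where "g = (\<lambda>z. exp (- K * real n * (e - infdist z (frontier G)) ^ CARD('d)))"
  have intg: "integrable lborel (\<lambda>z. indicator B z *\<^sub>R (2 * g z))"
    unfolding B_def g_def
    by (intro borel_integrable_compact compact_ball_nbhd[OF T] continuous_intros)
  have EV: "expectation V \<le> 2 * (e * exp_term G K n e)"
  proof -
    interpret M_lborel: pair_sigma_finite M lborel ..
    have "ennreal (expectation V) = (\<integral>\<^sup>+\<omega>. ennreal (V \<omega>) \<partial>M)"
      using intV by (intro nn_integral_eq_integral[symmetric]) (auto simp: V_def)
    also have "\<dots> = (\<integral>\<^sup>+\<omega>. emeasure lborel (Pair \<omega> -` D') \<partial>M)"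
    proof (intro nn_integral_cong)
      fix \<omega> assume w: "\<omega> \<in> space M"
      show "ennreal (V \<omega>) = emeasure lborel (Pair \<omega> -` D')"
        using diff[OF w] unfolding secD(2)[OF w] V_def
        by (intro emeasure_eq_ennreal_measure[symmetric]) (auto simp: fmeasurable_def)
    qed
    also have "\<dots> = emeasure (M \<Otimes>\<^sub>M lborel) D'"
      by (rule lborel.emeasure_pair_measure_alt[OF D', symmetric])
    also have "\<dots> = (\<integral>\<^sup>+z. emeasure M ((\<lambda>\<omega>. (\<omega>, z)) -` D') \<partial>lborel)"
      by (rule M_lborel.emeasure_pair_measure_alt2[OF D'])
    also have "\<dots> \<le> (\<integral>\<^sup>+z. ennreal (indicator B z *\<^sub>R (2 * g z)) \<partial>lborel)"
    proof (rule nn_integral_mono)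
      fix z :: "real ^ 'd"
      show "emeasure M ((\<lambda>\<omega>. (\<omega>, z)) -` D') \<le> ennreal (indicator B z *\<^sub>R (2 * g z))"
      proof (cases "z \<in> B")
        case True
        then have "(\<lambda>\<omega>. (\<omega>, z)) -` D' = {\<omega> \<in> space M. z \<notin> est n e \<omega>}"
          by (auto simp: D'_def D_def space_pair_measure)
        then show ?thesis
          using miss[of z] True by (simp add: emeasure_eq_measure B_def g_def ennreal_leI)
      next
        case False
        then have "(\<lambda>\<omega>. (\<omega>, z)) -` D' = {}" by (auto simp: D'_def)
        then show ?thesis by simp
      qed
    qed
    also have "\<dots> = ennreal (\<integral>z. indicator B z *\<^sub>R (2 * g z) \<partial>lborel)"
      by (rule nn_integral_eq_integral[OF intg]) (auto simp: g_def)
    also have "(\<integral>z. indicator B z *\<^sub>R (2 * g z) \<partial>lborel) = 2 * (e * exp_term G K n e)"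
      using e by (simp add: exp_term_def set_lebesgue_integral_def B_def g_def mult.left_commute)
    finally show ?thesis
      using e exp_term_nonneg[OF e, of G K n] by (subst (asm) ennreal_le_iff) auto
  qed
  have "expectation (abs_error Z \<delta> L0 n e) \<le> expectation (\<lambda>\<omega>. \<bar>tube_ratio G e - L0\<bar> + V \<omega> / (2 * e))"
    using AE_le int intV by (intro integral_mono_AE) auto
  also have "\<dots> = \<bar>tube_ratio G e - L0\<bar> + expectation V / (2 * e)"
    using intV by (simp add: prob_space)
  also have "expectation V / (2 * e) \<le> exp_term G K n e"
    using EV e by (simp add: field_simps)
  finally show "expectation (abs_error Z \<delta> L0 n e) \<le> error_bound G L0 K n e"
    by (simp add: error_bound_def)
qed

end

text \<open>
  Standardness in terms of Lebesgue measure: multiply by the volumes of the two sets and insert the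
  volume of a ball. That \<open>cbox 0 1 - G\<close> has positive volume is itself a consequence of standardness, as the
  uniform measure on a null set is the zero measure.
\<close>

lemma density_bound_from_standard:
  fixes G :: "(real ^ 'd) set"
  assumes G: "compact G" "measure lborel G > 0" "G \<subseteq> box 0 1" and T: "frontier G \<noteq> {}"
    and standard: "\<exists>C>0. \<exists>\<epsilon>\<^sub>0>0. \<forall>e\<in>{0<..\<epsilon>\<^sub>0}. \<forall>t\<in>frontier G.
          measure (uniform_measure lborel G) (cball t e) \<ge> C * measure lborel (cball t e) \<and>
          measure (uniform_measure lborel (cbox 0 1 - G)) (cball t e) \<ge> C * measure lborel (cball t e)"
  obtains C e0 where "C > 0" "e0 > 0"
    "\<And>e t. 0 < e \<Longrightarrow> e \<le> e0 \<Longrightarrow> t \<in> frontier G \<Longrightarrow> C * e ^ CARD('d) \<le> measure lborel (G \<inter> cball t e)"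
    "\<And>e t. 0 < e \<Longrightarrow> e \<le> e0 \<Longrightarrow> t \<in> frontier G \<Longrightarrow> C * e ^ CARD('d) \<le> measure lborel ((cbox 0 1 - G) \<inter> cball t e)"
proof -
  let ?R = "cbox 0 1 - G"
  obtain C e0 where C: "C > 0" and e0: "e0 > 0" and
    dG: "\<And>e t. 0 < e \<Longrightarrow> e \<le> e0 \<Longrightarrow> t \<in> frontier G \<Longrightarrow>
          measure (uniform_measure lborel G) (cball t e) \<ge> C * measure lborel (cball t e)" and
    dR: "\<And>e t. 0 < e \<Longrightarrow> e \<le> e0 \<Longrightarrow> t \<in> frontier G \<Longrightarrow>
          measure (uniform_measure lborel ?R) (cball t e) \<ge> C * measure lborel (cball t e)"
    using standard by (auto simp: Ball_def)
  define v where "v = unit_ball_vol (real CARD('d))"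
  have v: "v > 0" by (simp add: v_def)
  have ball: "measure lborel (cball t e) = v * e ^ CARD('d)" if "0 < e" for e and t :: "real ^ 'd"
    using that by (simp add: content_cball v_def)
  have Gm: "G \<in> sets borel" using G(1) by (rule borel_compact)
  have finR: "emeasure lborel ?R \<noteq> \<infinity>"
  proof -
    have "emeasure lborel ?R \<le> emeasure lborel (cbox 0 (1 :: real ^ 'd))" by (intro emeasure_mono) auto
    then show ?thesis using emeasure_lborel_cbox_finite[of "0 :: real ^ 'd" 1] by (auto simp: top_unique)
  qed
  have conv: "measure (uniform_measure lborel S) (cball t e) * measure lborel S = measure lborel (S \<inter> cball t e)"
    if "measure lborel S > 0" "emeasure lborel S \<noteq> \<infinity>" for S :: "(real ^ 'd) set" and t e
  proof -
    have "emeasure lborel S \<noteq> 0" using that by (auto simp: measure_def)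
    then show ?thesis using that by (simp add: measure_uniform_measure)
  qed
  obtain t where t: "t \<in> frontier G" using T by blast
  have mR: "measure lborel ?R > 0"
  proof (rule ccontr)
    assume "\<not> measure lborel ?R > 0"
    then have "emeasure lborel ?R = 0"
      using finR by (simp add: emeasure_eq_ennreal_measure measure_le_0_iff not_less)
    then have "emeasure (uniform_measure lborel ?R) (cball t e0) = 0"
      using Gm by (subst emeasure_uniform_measure) (auto simp: emeasure_eq_0[of "cbox 0 1 - G"])
    then have "measure (uniform_measure lborel ?R) (cball t e0) = 0" by (simp add: measure_def)
    moreover have "C * measure lborel (cball t e0) > 0" using C v e0 by (simp add: ball)
    ultimately show False using dR[OF e0 order_refl t] by simp
  qed
  define C' where "C' = C * v * min (measure lborel G) (measure lborel ?R)"
  have bound: "C' * e ^ CARD('d) \<le> measure lborel (S \<inter> cball t e)"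
    if S: "S = G \<or> S = ?R" and e: "0 < e" "e \<le> e0" and t: "t \<in> frontier G" for S e t
  proof -
    have S0: "measure lborel S > 0" "emeasure lborel S \<noteq> \<infinity>"
      using S mR finR G(2) emeasure_compact_finite[OF G(1)] by auto
    have "C' * e ^ CARD('d) \<le> C * v * measure lborel S * e ^ CARD('d)"
      unfolding C'_def using S C v e by (intro mult_right_mono mult_left_mono) auto
    also have "\<dots> = C * measure lborel (cball t e) * measure lborel S"
      using ball[OF e(1), of t] by simp
    also have "\<dots> \<le> measure (uniform_measure lborel S) (cball t e) * measure lborel S"
      using dG[OF e t] dR[OF e t] S S0 by (intro mult_right_mono) auto
    finally show ?thesis using conv[OF S0] by simp
  qed
  show ?thesis
  proof (rule that[of C' e0])
    show "C' > 0" using C v G(2) mR by (simp add: C'_def)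
  qed (use e0 bound in auto)
qed

context labelled_sample
begin

text \<open>
  For \<open>\<epsilon> n\<close> up to some \<open>e1\<close> the tube lies in the cube and the mass bounds apply, with \<open>C\<close> as the
  constant in the exponent. Only finitely many \<open>n\<close> remain; for them \<open>K\<close> is chosen so small that twice the
  exponential is at least 1.
\<close>

lemma expectation_abs_error_le_error_bound:
  fixes \<epsilon> :: "nat \<Rightarrow> real"
  assumes G: "compact G" "G \<subseteq> box 0 1" and T: "frontier G \<noteq> {}"
    and C: "C > 0" "e0 > 0"
    and dens: "\<And>e t. 0 < e \<Longrightarrow> e \<le> e0 \<Longrightarrow> t \<in> frontier G \<Longrightarrow> C * e ^ CARD('d) \<le> measure lborel (G \<inter> cball t e)"
      "\<And>e t. 0 < e \<Longrightarrow> e \<le> e0 \<Longrightarrow> t \<in> frontier G \<Longrightarrow> C * e ^ CARD('d) \<le> measure lborel ((cbox 0 1 - G) \<inter> cball t e)"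
    and eps: "\<And>n. n \<ge> 1 \<Longrightarrow> \<epsilon> n > 0" "\<epsilon> \<longlonglongrightarrow> 0"
  shows "\<exists>K>0. \<forall>n\<ge>1. integrable M (abs_error Z \<delta> L0 n (\<epsilon> n)) \<and>
           expectation (abs_error Z \<delta> L0 n (\<epsilon> n)) \<le> error_bound G L0 K n (\<epsilon> n)"
proof -
  let ?T = "frontier G" and ?d = "CARD('d)"
  have Tc: "compact ?T" using G(1) by (rule compact_frontier)
  have "?T \<subseteq> box 0 1" using G frontier_subset_closed[of G] by (auto simp: compact_imp_closed)
  then obtain \<eta> where \<eta>: "\<eta> > 0" "(\<Union>x\<in>?T. ball x \<eta>) \<subseteq> box 0 1"
    using compact_subset_open_imp_ball_epsilon_subset[OF Tc open_box] by blast
  define e1 where "e1 = min (\<eta> / 2) e0"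
  have e1: "e1 > 0" "e1 < \<eta>" "e1 \<le> e0" using \<eta> C by (auto simp: e1_def)
  have in_cube: "ball_nbhd ?T e \<subseteq> cbox 0 1" if "e \<le> e1" for e
  proof -
    have "ball_nbhd ?T e \<subseteq> (\<Union>x\<in>?T. ball x \<eta>)" using that e1 by (force simp: ball_nbhd_def)
    then show ?thesis using \<eta>(2) box_subset_cbox by blast
  qed
  define J where "J = {n. n \<ge> 1 \<and> \<epsilon> n > e1}"
  have "\<forall>\<^sub>F n in sequentially. \<epsilon> n < e1" using eps(2) e1(1) by (rule order_tendstoD)
  then obtain N where N: "\<And>n. n \<ge> N \<Longrightarrow> \<epsilon> n < e1" unfolding eventually_sequentially by blast
  have "J \<subseteq> {..<N}" using N by (force simp: J_def not_le[symmetric])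
  then have finJ: "finite J" by (rule finite_subset) simp
  define S where "S = (\<Sum>n\<in>J. real n * \<epsilon> n ^ ?d)"
  have pos: "real n * \<epsilon> n ^ ?d \<ge> 0" if "n \<in> J" for n using that eps(1) by (simp add: J_def less_imp_le)
  have S: "S \<ge> 0" unfolding S_def by (intro sum_nonneg pos)
  \<comment> \<open>\<open>S\<close> dominates every exponent \<open>n * (\<epsilon> n) ^ d\<close> that occurs for an exceptional \<open>n\<close>.\<close>
  define K where "K = min C (ln 2 / (1 + S))"
  have K: "K > 0" "K \<le> C" "K * S \<le> ln 2"
  proof -
    show "K > 0" using C S by (simp add: K_def add_pos_nonneg)
    have "K * S \<le> ln 2 / (1 + S) * S" using S by (intro mult_right_mono) (auto simp: K_def)
    also have "\<dots> \<le> ln 2" using S by (simp add: field_simps)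
    finally show "K * S \<le> ln 2" .
  qed (simp add: K_def)
  have "prob {\<omega> \<in> space M. z \<notin> est n (\<epsilon> n) \<omega>}
        \<le> 2 * exp (- K * real n * (\<epsilon> n - infdist z ?T) ^ ?d)"
    if n: "n \<ge> 1" and z: "z \<in> ball_nbhd ?T (\<epsilon> n)" for n z
  proof -
    obtain t where t: "t \<in> ?T" "infdist z ?T = dist z t"
      using infdist_attains_inf[OF frontier_closed T] .
    define u where "u = \<epsilon> n - infdist z ?T"
    have u: "0 \<le> u" "u \<le> \<epsilon> n"
      using z ball_nbhd_eq_infdist_le[OF frontier_closed T] infdist_nonneg[of z ?T] by (auto simp: u_def)
    have "prob {\<omega> \<in> space M. z \<notin> est n (\<epsilon> n) \<omega>} \<le> 2 * exp (- (K * (real n * u ^ ?d)))"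
    proof (cases "\<epsilon> n \<le> e1")
      case True
      have cball: "cball t u \<subseteq> cball z (\<epsilon> n)"
        unfolding subset_iff mem_cball
      proof safe
        fix x assume "dist t x \<le> u"
        then show "dist z x \<le> \<epsilon> n" using dist_triangle[of z x t] t(2) by (simp add: u_def)
      qed
      \<comment> \<open>On the rim of the tube \<open>u = 0\<close>, where the density bound does not apply but the claim is trivial.\<close>
      have mass: "C * u ^ ?d \<le> label_mass k z (\<epsilon> n)" if "k \<in> {0, 1}" for k
      proof (cases "u = 0")
        case False
        define A where "A = (if k = 1 then G else cbox 0 1 - G)"
        have "C * u ^ ?d \<le> measure lborel (A \<inter> cball t u)"
          using dens[of u t] t u False True e1 by (simp add: A_def)
        also have "\<dots> \<le> label_mass k z (\<epsilon> n)"
          unfolding label_mass_def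
        proof (rule measure_mono_fmeasurable)
          show "A \<inter> cball t u \<subseteq> {x \<in> cbox 0 1. (if x \<in> G then 1 else 0) = k \<and> norm (x - z) \<le> \<epsilon> n}"
            using cball that G(2) box_subset_cbox[of 0 "1 :: real ^ 'd"]
            by (auto simp: A_def dist_norm norm_minus_commute subset_iff)
          show "A \<inter> cball t u \<in> sets lborel" by (auto simp: A_def)
          have "{x \<in> cbox 0 1. (if x \<in> G then 1 else 0) = k \<and> norm (x - z) \<le> \<epsilon> n} \<in> sets lborel"
            by measurable
          then show "{x \<in> cbox 0 1. (if x \<in> G then 1 else 0) = k \<and> norm (x - z) \<le> \<epsilon> n} \<in> fmeasurable lborel"
            by (rule fmeasurableI2[of "cbox 0 1", rotated 2])
               (use emeasure_lborel_cbox_finite[of "0 :: real ^ 'd" 1] in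
                 \<open>auto simp: fmeasurable_def less_top\<close>)
        qed
        finally show ?thesis .
      qed (simp add: label_mass_def zero_power)
      have "prob (missed k n z (\<epsilon> n)) \<le> exp (- (K * (real n * u ^ ?d)))" if "k \<in> {0, 1}" for k
      proof -
        have "K * u ^ ?d \<le> label_mass k z (\<epsilon> n)"
          using mass[OF that] K(2) u(1) by (meson mult_right_mono order_trans zero_le_power)
        then have "real n * (K * u ^ ?d) \<le> real n * label_mass k z (\<epsilon> n)" by (rule mult_left_mono) simp
        then show ?thesis
          using prob_missed_le[of k n z "\<epsilon> n"] by (simp add: mult.left_commute order_trans)
      qed
      from this[of 0] this[of 1]
      have "prob (missed 0 n z (\<epsilon> n)) + prob (missed 1 n z (\<epsilon> n)) \<le> 2 * exp (- (K * (real n * u ^ ?d)))" by simp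
      moreover have "z \<in> cbox 0 1" using in_cube[OF True] z by blast
      ultimately show ?thesis
        using not_in_est[of z n "\<epsilon> n"] measure_Un_le[OF missed_events[of 0 n z "\<epsilon> n"] missed_events[of 1 n z "\<epsilon> n"]]
        by simp
    next
      case False
      then have nJ: "n \<in> J" using n by (simp add: J_def)
      have "real n * u ^ ?d \<le> real n * \<epsilon> n ^ ?d" using u by (intro mult_left_mono power_mono) auto
      also have "\<dots> \<le> S" unfolding S_def using nJ finJ pos by (intro member_le_sum) auto
      finally have "K * (real n * u ^ ?d) \<le> K * S" using K(1) by (intro mult_left_mono) auto
      then have "exp (- ln 2) \<le> exp (- (K * (real n * u ^ ?d)))" using K(3) by simp
      then have "1 \<le> 2 * exp (- (K * (real n * u ^ ?d)))" by (simp add: exp_minus)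
      then show ?thesis using prob_le_1[of "{\<omega> \<in> space M. z \<notin> est n (\<epsilon> n) \<omega>}"] by linarith
    qed
    then show ?thesis by (simp add: u_def mult.assoc)
  qed
  then show ?thesis
    using expectation_abs_error_le[OF Tc eps(1)] K(1) by blast
qed

end

section \<open>Rates of convergence\<close>

lemma error_bound_rate:
  fixes G :: "(real ^ 'd) set" and \<epsilon> :: "nat \<Rightarrow> real"
  assumes a: "\<And>e. 0 < e \<Longrightarrow> e \<le> a0 \<Longrightarrow> \<bar>tube_ratio G e - L0\<bar> \<le> A * e" "a0 > 0" "A > 0"
    and b: "\<And>n e. 1 \<le> n \<Longrightarrow> 0 < e \<Longrightarrow> e \<le> b0 \<Longrightarrow>
        exp_term G K n e \<le> B * (real n * e ^ CARD('d)) powr (- 1 / real CARD('d))" "b0 > 0" "B > 0"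
    and eps: "\<And>n. n \<ge> 1 \<Longrightarrow> \<epsilon> n > 0" "\<epsilon> \<longlonglongrightarrow> 0"
  shows "(\<lambda>n. error_bound G L0 K n (\<epsilon> n)) \<in> O(\<lambda>n. (real n * \<epsilon> n ^ CARD('d)) powr (- 1 / real CARD('d)) + \<epsilon> n)"
proof (rule bigoI[where c = "A + B"])
  have "\<forall>\<^sub>F n in sequentially. \<epsilon> n < min a0 b0" using eps(2) a(2) b(2) by (intro order_tendstoD(2)) auto
  then show "\<forall>\<^sub>F n in sequentially. norm (error_bound G L0 K n (\<epsilon> n))
      \<le> (A + B) * norm ((real n * \<epsilon> n ^ CARD('d)) powr (- 1 / real CARD('d)) + \<epsilon> n)"
    using eventually_ge_at_top[of 1]
  proof eventually_elim
    case (elim n)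
    let ?p = "(real n * \<epsilon> n ^ CARD('d)) powr (- 1 / real CARD('d))"
    have e: "0 < \<epsilon> n" "\<epsilon> n \<le> a0" "\<epsilon> n \<le> b0" using elim eps(1) by auto
    have "0 \<le> error_bound G L0 K n (\<epsilon> n)"
      using exp_term_nonneg[OF e(1), of G K n] by (simp add: error_bound_def)
    moreover have "error_bound G L0 K n (\<epsilon> n) \<le> B * ?p + A * \<epsilon> n"
      unfolding error_bound_def using a(1)[OF e(1,2)] b(1)[OF elim(2) e(1,3)] by (rule add_mono[rotated])
    moreover have "B * ?p + A * \<epsilon> n \<le> (A + B) * (?p + \<epsilon> n)"
      using a(3) b(3) e(1) by (simp add: algebra_simps)
    moreover have "0 \<le> ?p + \<epsilon> n" using e(1) by (simp add: add_nonneg_nonneg)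
    ultimately show ?case by simp
  qed
qed

lemma powr_neg_inverse_dim:
  fixes e :: real
  assumes "n \<ge> 1" "e > 0" "d \<ge> 1"
  shows "(real n * e ^ d) powr (- 1 / real d) = real n powr (- 1 / real d) / e"
  using assms by (simp add: powr_mult powr_realpow[symmetric] powr_powr powr_minus_divide)

lemma balanced_rate:
  assumes "d \<ge> 1" "n \<ge> 1"
  shows "(real n * (real n powr (- 1 / (2 * real d))) ^ d) powr (- 1 / real d) = real n powr (- 1 / (2 * real d))"
proof -
  have "(real n * (real n powr (- 1 / (2 * real d))) ^ d) powr (- 1 / real d)
      = real n powr (- 1 / real d) / real n powr (- 1 / (2 * real d))"
    using assms by (intro powr_neg_inverse_dim) auto
  also have "\<dots> = real n powr (- 1 / real d - - 1 / (2 * real d))" by (rule powr_diff[symmetric])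
  also have "- 1 / real d - - 1 / (2 * real d) = - 1 / (2 * real d)" using assms by (simp add: field_simps)
  finally show ?thesis .
qed

text \<open>
  With \<open>h\<close> denoting the left-hand side, the right-hand side is \<open>h\<^sup>2 / e + e\<close>, and one of the two
  summands is at least \<open>h\<close>.
\<close>

lemma rate_lower_bound:
  fixes e :: real
  assumes "n \<ge> 1" "e > 0" "d \<ge> 1"
  shows "real n powr (- 1 / (2 * real d)) \<le> (real n * e ^ d) powr (- 1 / real d) + e"
proof -
  define h where "h = real n powr (- 1 / (2 * real d))"
  have h: "h > 0" using assms by (simp add: h_def)
  have hh: "real n powr (- 1 / real d) = h * h"
    using assms by (simp add: h_def powr_add[symmetric] field_simps)
  have "h \<le> h * h / e + e"
  proof (cases "h \<le> e")
    case True
    then show ?thesis using assms by (simp add: add_increasing)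
  next
    case False
    then have "h * e \<le> h * h" using h by (intro mult_left_mono) auto
    then have "h \<le> h * h / e" using assms by (simp add: field_simps)
    then show ?thesis using assms by simp
  qed
  then show ?thesis using powr_neg_inverse_dim[OF assms] hh by (simp add: h_def)
qed

lemma tendsto_root_scale: "d \<ge> 1 \<Longrightarrow> (\<lambda>n. real n powr (- 1 / (2 * real d))) \<longlonglongrightarrow> 0"
  by (intro tendsto_neg_powr filterlim_real_sequentially) auto

theorem corollary1:
  fixes G R :: "(real ^ 'd) set"
    and L0 :: real
    and M :: "'w measure"
    and Z :: "nat \<Rightarrow> 'w \<Rightarrow> real ^ 'd"
    and \<delta> :: "nat \<Rightarrow> 'w \<Rightarrow> nat"
    and \<epsilon> :: "nat \<Rightarrow> real"
  defines "R \<equiv> cbox 0 1 - G"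
  assumes body: "compact G" "measure lborel G > 0" "G \<subseteq> box 0 1"
    and content: "(tube_ratio G \<longlongrightarrow> L0) (at_right 0)" "L0 > 0"
    and sample: "iid_copies M (borel \<Otimes>\<^sub>M count_space UNIV) (\<lambda>i \<omega>. (Z i \<omega>, \<delta> i \<omega>)) (sample_law G)"
    and standard: "\<exists>C>0. \<exists>\<epsilon>\<^sub>0>0. \<forall>e\<in>{0<..\<epsilon>\<^sub>0}. \<forall>t\<in>frontier G.
          measure (uniform_measure lborel G) (cball t e) \<ge> C * measure lborel (cball t e) \<and>
          measure (uniform_measure lborel R) (cball t e) \<ge> C * measure lborel (cball t e)"
    and smooth: "\<exists>\<eta>>0. \<exists>F'.
          (\<forall>e\<in>{0..<\<eta>}. (tube_volume G has_real_derivative F' e) (at e within {0..})) \<and>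
          continuous (at 0 within {0..}) F'"
    and eps: "\<And>n. n \<ge> 1 \<Longrightarrow> \<epsilon> n > 0" "\<epsilon> \<longlonglongrightarrow> 0"
  shows
    "(\<exists>K>0. \<forall>n\<ge>1.
        integrable M (abs_error Z \<delta> L0 n (\<epsilon> n)) \<and>
        prob_space.expectation M (abs_error Z \<delta> L0 n (\<epsilon> n)) \<le> error_bound G L0 K n (\<epsilon> n)) \<and>
     (filterlim (\<lambda>n. real n * \<epsilon> n ^ CARD('d)) at_top sequentially \<longrightarrow>
        (\<lambda>n. prob_space.expectation M (abs_error Z \<delta> L0 n (\<epsilon> n))) \<longlonglongrightarrow> 0) \<and>
     (reach G > 0 \<and> reach (closure R) > 0 \<longrightarrow>
        (\<forall>K>0. (\<lambda>n. error_bound G L0 K n (\<epsilon> n))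
            \<in> O(\<lambda>n. (real n * \<epsilon> n ^ CARD('d)) powr (- 1 / real CARD('d)) + \<epsilon> n)) \<and>
        (\<forall>K>0. (\<lambda>n. error_bound G L0 K n (real n powr (- 1 / (2 * real CARD('d)))))
            \<in> O(\<lambda>n. real n powr (- 1 / (2 * real CARD('d))))) \<and>
        (\<lambda>n. prob_space.expectation M
               (abs_error Z \<delta> L0 n (real n powr (- 1 / (2 * real CARD('d))))))
            \<in> O(\<lambda>n. real n powr (- 1 / (2 * real CARD('d)))) \<and>
        (\<exists>c>0. \<forall>e :: nat \<Rightarrow> real. (\<forall>n\<ge>1. e n > 0) \<longrightarrow>
            (\<forall>n\<ge>1. (real n * e n ^ CARD('d)) powr (- 1 / real CARD('d)) + e n
                     \<ge> c * real n powr (- 1 / (2 * real CARD('d))))))"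
proof (intro conjI impI)
  let ?T = "frontier G" and ?d = "CARD('d)"
  let ?err = "\<lambda>n e. prob_space.expectation M (abs_error Z \<delta> L0 n e)"
  interpret labelled_sample G M Z \<delta>
    using body(1) sample by unfold_locales (auto intro: borel_compact)
  have Tc: "compact ?T" using body(1) by (rule compact_frontier)
  have T: "?T \<noteq> {}"
  proof
    assume "?T = {}"
    then have "tube_ratio G = (\<lambda>_. 0)" by (simp add: tube_ratio_def tube_volume_def ball_nbhd_def fun_eq_iff)
    then have "L0 = 0" using content(1) by (auto simp: tendsto_const_iff)
    then show False using content(2) by simp
  qed
  obtain C e0 where C: "C > 0" "e0 > 0"
    and dens: "\<And>e t. 0 < e \<Longrightarrow> e \<le> e0 \<Longrightarrow> t \<in> ?T \<Longrightarrow> C * e ^ ?d \<le> measure lborel (G \<inter> cball t e)"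
      "\<And>e t. 0 < e \<Longrightarrow> e \<le> e0 \<Longrightarrow> t \<in> ?T \<Longrightarrow> C * e ^ ?d \<le> measure lborel ((cbox 0 1 - G) \<inter> cball t e)"
    using density_bound_from_standard[OF body T standard[unfolded R_def]] by blast
  note bound = expectation_abs_error_le_error_bound[OF body(1,3) T C dens, where ?L0.0 = L0]
  show part_a: "\<exists>K>0. \<forall>n\<ge>1. integrable M (abs_error Z \<delta> L0 n (\<epsilon> n)) \<and> ?err n (\<epsilon> n) \<le> error_bound G L0 K n (\<epsilon> n)"
    by (rule bound[OF _ _ _ _ _ _ eps])
  have err_nonneg: "?err n e \<ge> 0" for n e
    by (intro Bochner_Integration.integral_nonneg) (simp add: abs_error_def)
  {
    assume big: "filterlim (\<lambda>n. real n * \<epsilon> n ^ ?d) at_top sequentially"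
    obtain K where K: "K > 0" "\<And>n. n \<ge> 1 \<Longrightarrow> ?err n (\<epsilon> n) \<le> error_bound G L0 K n (\<epsilon> n)"
      using part_a by blast
    have ev: "\<forall>\<^sub>F n in sequentially. \<epsilon> n > 0"
      using eventually_ge_at_top[of 1] by eventually_elim (rule eps(1))
    have "filterlim \<epsilon> (at_right 0) sequentially"
      using eps(2) ev by (rule tendsto_imp_filterlim_at_right)
    then have "(\<lambda>n. tube_ratio G (\<epsilon> n)) \<longlonglongrightarrow> L0" by (rule filterlim_compose[OF content(1)])
    then have "(\<lambda>n. exp_term G K n (\<epsilon> n) + \<bar>tube_ratio G (\<epsilon> n) - L0\<bar>) \<longlonglongrightarrow> 0 + \<bar>L0 - L0\<bar>"
      by (intro tendsto_intros exp_term_tendsto_0[OF Tc T content K(1) ev eps(2) big])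
    then have lim: "(\<lambda>n. error_bound G L0 K n (\<epsilon> n)) \<longlonglongrightarrow> 0" by (simp add: error_bound_def)
    show "(\<lambda>n. ?err n (\<epsilon> n)) \<longlonglongrightarrow> 0"
    proof (rule tendsto_sandwich[OF _ _ tendsto_const lim])
      show "\<forall>\<^sub>F n in sequentially. ?err n (\<epsilon> n) \<le> error_bound G L0 K n (\<epsilon> n)"
        using eventually_ge_at_top[of 1] by eventually_elim (rule K(2))
    qed (simp add: err_nonneg)
  }
  {
    assume reach: "reach G > 0 \<and> reach (closure R) > 0"
    obtain r1 where r1: "r1 > 0" "unique_proj_below r1 G" using reach reach_pos_imp_unique_proj by blast
    obtain r2 where r2: "r2 > 0" "unique_proj_below r2 (closure R)" using reach reach_pos_imp_unique_proj by blast
    have null: "measure lborel ?T = 0" "tube_volume G 0 = 0"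
      using measure_frontier_eq_0[OF content(1) Tc] .
    have thick: "?T \<subseteq> closure (interior G)"
    proof (rule frontier_subset_closure_interior[OF compact_imp_closed[OF body(1)] null(1) Tc _ C(2)])
      fix t e assume "t \<in> ?T" "0 < e" "e \<le> e0"
      moreover have "0 < C * e ^ ?d" using C \<open>0 < e\<close> by simp
      ultimately show "0 < measure lborel (G \<inter> cball t e)" using dens(1)[of e t] by linarith
    qed
    have QR: "box 0 1 - G \<subseteq> R" "R \<inter> G = {}" using box_subset_cbox[of 0 "1 :: real ^ 'd"] by (auto simp: R_def)
    obtain \<rho> \<nu> where \<rho>: "\<rho> > 0" "two_sided_normal \<rho> G \<nu>"
      using two_sided_normal_exists[OF body(1) open_box body(3) QR r1(2,1) r2(2,1) thick] by blast
    obtain A a0 where A: "A > 0" "a0 > 0" "\<And>e. 0 < e \<Longrightarrow> e \<le> a0 \<Longrightarrow> \<bar>tube_ratio G e - L0\<bar> \<le> A * e"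
      using tube_ratio_rate[OF \<rho> body(1) null(1) content(1)] by blast
    obtain B b0 where B: "B > 0" "b0 > 0"
      "\<And>a b. 0 \<le> a \<Longrightarrow> a \<le> b \<Longrightarrow> b \<le> b0 \<Longrightarrow> tube_volume G b - tube_volume G a \<le> B * (b - a)"
      using tube_volume_lipschitz_near_0[OF smooth] by blast
    have rate: "(\<lambda>n. error_bound G L0 K n (e n)) \<in> O(\<lambda>n. (real n * e n ^ ?d) powr (- 1 / real ?d) + e n)"
      if "K > 0" "\<And>n. n \<ge> 1 \<Longrightarrow> e n > 0" "e \<longlonglongrightarrow> 0" for K and e :: "nat \<Rightarrow> real"
    proof (rule error_bound_rate[OF A(3,2,1) _ B(2) _ that(2,3)])
      show "0 < B / (1 - exp (- K))" using B that by simp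
      fix n :: nat and x :: real assume "1 \<le> n" "0 < x" "x \<le> b0"
      then show "exp_term G K n x \<le> B / (1 - exp (- K)) * (real n * x ^ ?d) powr (- 1 / real ?d)"
        using exp_term_rate[OF Tc T null(2) B(3,1)] that(1) by blast
    qed
    show "\<forall>K>0. (\<lambda>n. error_bound G L0 K n (\<epsilon> n)) \<in> O(\<lambda>n. (real n * \<epsilon> n ^ ?d) powr (- 1 / real ?d) + \<epsilon> n)"
      using rate eps by blast
    define s where "s = (\<lambda>n. real n powr (- 1 / (2 * real ?d)))"
    have s: "s n > 0" if "n \<ge> 1" for n using that by (simp add: s_def)
    have s0: "s \<longlonglongrightarrow> 0" unfolding s_def by (rule tendsto_root_scale) (simp add: Suc_leI)
    have bal: "(\<lambda>n. (real n * s n ^ ?d) powr (- 1 / real ?d) + s n) \<in> O(s)"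
    proof (rule bigoI[where c = 2])
      show "\<forall>\<^sub>F n in sequentially. norm ((real n * s n ^ ?d) powr (- 1 / real ?d) + s n) \<le> 2 * norm (s n)"
        using eventually_ge_at_top[of 1]
      proof eventually_elim
        case (elim n)
        then show ?case using balanced_rate[of ?d n] s[OF elim] by (simp add: s_def Suc_leI)
      qed
    qed
    have s_rate: "(\<lambda>n. error_bound G L0 K n (s n)) \<in> O(s)" if "K > 0" for K
      by (rule landau_o.big_trans[OF rate[OF that s s0] bal])
    then show "\<forall>K>0. (\<lambda>n. error_bound G L0 K n (real n powr (- 1 / (2 * real ?d))))
            \<in> O(\<lambda>n. real n powr (- 1 / (2 * real ?d)))"
      by (simp add: s_def)
    obtain K where K: "K > 0" "\<And>n. n \<ge> 1 \<Longrightarrow> ?err n (s n) \<le> error_bound G L0 K n (s n)"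
      using bound[OF _ _ _ _ _ _ s s0] by blast
    have "(\<lambda>n. ?err n (s n)) \<in> O(\<lambda>n. error_bound G L0 K n (s n))"
    proof (rule bigoI[where c = 1])
      show "\<forall>\<^sub>F n in sequentially. norm (?err n (s n)) \<le> 1 * norm (error_bound G L0 K n (s n))"
        using eventually_ge_at_top[of 1]
      proof eventually_elim
        case (elim n)
        then show ?case using K(2)[OF elim] err_nonneg[of n "s n"] by simp
      qed
    qed
    then show "(\<lambda>n. ?err n (real n powr (- 1 / (2 * real ?d)))) \<in> O(\<lambda>n. real n powr (- 1 / (2 * real ?d)))"
      using landau_o.big_trans[OF _ s_rate[OF K(1)]] unfolding s_def by blast
    show "\<exists>c>0. \<forall>e :: nat \<Rightarrow> real. (\<forall>n\<ge>1. e n > 0) \<longrightarrow>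
            (\<forall>n\<ge>1. (real n * e n ^ ?d) powr (- 1 / real ?d) + e n \<ge> c * real n powr (- 1 / (2 * real ?d)))"
      using rate_lower_bound[where d = ?d] by (intro exI[of _ 1]) (simp add: Suc_leI)
  }
qed

end
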